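(* Let $\Bbbk$ be a field, $\Gamma=(V,E)$ a connected graph and $v$ a collection of skew-zigzag coefficients for $\Gamma$. Then the skew-zigzag algebra $A_v(\Gamma)$ is a graded Frobenius algebra. In addition, the zigzag algebra $A(\Gamma)$ is a graded symmetric algebra.
   Context: Graphs $\Gamma=(V,E)$ are finite, with no loops or multiple edges ($E$ is a set of two-element subsets of $V$). The double graph $D\Gamma$ is the quiver with vertex set $V$ and, for each $\{a,b\}\in E$, two directed edges $(a\,|\,b)$ (from $a$ to $b$) and $(b\,|\,a)$ (from $b$ to $a$). Paths in $D\Gamma$ are written $(a_1\,|\,\dots\,|\,a_n)$ (with $\{a_i,a_{i+1}\}\in E$), of length $n-1$, with $(a)$ the trivial path at $a$. The path algebra $\Bbbk D\Gamma$ has the paths as basis and multiplication by concatenation (zero if the end of the first is not the start of the second), graded by path length. A collection of skew-zigzag coefficients is a family $v=(v^a_{b,c}\in\Bbbk : \{a,b\},\{a,c\}\in E)$ with $v^a_{b,b}=1$, $v^a_{b,c}v^a_{c,b}=1$, and $v^a_{b,c}v^a_{c,d}v^a_{d,b}=1$ whenever the vertices $b,c,d$ involved are all adjacent to $a$. The skew-zigzag algebra $A_v(\Gamma)$ is defined as follows. If $|V|=1$: $A_v(\Gamma)$ is the algebra generated by $1$ and $X$ with $X^2=0$, with $X$ in degree $2$. If $|V|=2$: $A_v(\Gamma)$ is the quotient of $\Bbbk D\Gamma$ by the two-sided ideal generated by all paths of length greater than two. If $|V|\ge 3$: $A_v(\Gamma)=\Bbbk D\Gamma/I_v$, where $I_v$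 is the two-sided ideal generated by all paths $(a_1\,|\,a_2\,|\,a_3)$ with $a_1\ne a_3$ and all $(a_1\,|\,a_2\,|\,a_1)-v^{a_1}_{a_2,a_3}(a_1\,|\,a_3\,|\,a_1)$ with $a_1$ adjacent to $a_2$ and $a_3$. $A_v(\Gamma)$ is graded by path length. The zigzag algebra $A(\Gamma)$ is $A_v(\Gamma)$ with all $v^a_{b,c}=1$. A trace map on a finite-dimensional unital associative $\Bbbk$-algebra $A$ is a $\Bbbk$-linear map $\mathrm{tr}:A\to\Bbbk$; it is nondegenerate (respectively symmetric) if the bilinear form $(x,y)\mapsto\mathrm{tr}(xy)$ is nondegenerate (respectively symmetric). $A$ is a Frobenius algebra if it admits a nondegenerate trace map, and a symmetric algebra if it admits a nondegenerate symmetric trace map. For a graded algebra, "graded Frobenius" (respectively "graded symmetric") means that such a trace map can be chosen homogeneous, i.e. vanishing on all but one graded component. *)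

theory Defs
  imports
    "Graph_Theory.Digraph_Component"
    "Graph_Theory.Vertex_Walk"
    "HOL-Algebra.QuotRing"
    "HOL-Algebra.Module"
begin

section \<open>Frobenius and symmetric algebras\<close>

text \<open>The locale \<^locale>\<open>algebra\<close> of HOL-Algebra is restricted to commutative rings \<open>A\<close>.\<close>

locale unital_algebra = module K A + K: field K + A: ring A for K (structure) and A (structure) +
  assumes smult_mult_left:
      "\<lbrakk>c \<in> carrier K; x \<in> carrier A; y \<in> carrier A\<rbrakk> \<Longrightarrow>
        (c \<odot>\<^bsub>A\<^esub> x) \<otimes>\<^bsub>A\<^esub> y = c \<odot>\<^bsub>A\<^esub> (x \<otimes>\<^bsub>A\<^esub> y)"
    and smult_mult_right:
      "\<lbrakk>c \<in> carrier K; x \<in> carrier A; y \<in> carrier A\<rbrakk> \<Longrightarrow>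
        x \<otimes>\<^bsub>A\<^esub> (c \<odot>\<^bsub>A\<^esub> y) = c \<odot>\<^bsub>A\<^esub> (x \<otimes>\<^bsub>A\<^esub> y)"

locale fin_dim_algebra = unital_algebra +
  assumes fin_dim: "\<exists>B. finite B \<and> B \<subseteq> carrier A \<and>
    (\<forall>x\<in>carrier A. \<exists>c. (\<forall>b\<in>B. c b \<in> carrier K) \<and> x = (\<Oplus>\<^bsub>A\<^esub>b\<in>B. c b \<odot>\<^bsub>A\<^esub> b))"

text \<open>\<open>G n\<close> is the homogeneous component of degree \<open>n\<close>; the last assumption says that
  the algebra is the direct sum of its homogeneous components.\<close>

locale graded_algebra = unital_algebra +
  fixes G :: "nat \<Rightarrow> 'c set"
  assumes graded_submodule: "submodule (G n) K A"
    and graded_mult: "\<lbrakk>x \<in> G m; y \<in> G n\<rbrakk> \<Longrightarrow> x \<otimes>\<^bsub>A\<^esub> y \<in> G (m + n)"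
    and graded_direct_sum: "x \<in> carrier A \<Longrightarrow>
      \<exists>!f. (\<forall>n. f n \<in> G n) \<and> finite {n. f n \<noteq> \<zero>\<^bsub>A\<^esub>} \<and>
        x = (\<Oplus>\<^bsub>A\<^esub>n\<in>{n. f n \<noteq> \<zero>\<^bsub>A\<^esub>}. f n)"

definition trace_map ::
  "('k, 'm) ring_scheme \<Rightarrow> ('k, 'b, 'n) module_scheme \<Rightarrow> ('b \<Rightarrow> 'k) \<Rightarrow> bool" where
  "trace_map K A tr \<longleftrightarrow>
    (\<forall>x\<in>carrier A. tr x \<in> carrier K) \<and>
    (\<forall>x\<in>carrier A. \<forall>y\<in>carrier A. tr (x \<oplus>\<^bsub>A\<^esub> y) = tr x \<oplus>\<^bsub>K\<^esub> tr y) \<and>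
    (\<forall>c\<in>carrier K. \<forall>x\<in>carrier A. tr (c \<odot>\<^bsub>A\<^esub> x) = c \<otimes>\<^bsub>K\<^esub> tr x)"

definition nondegenerate_trace ::
  "('k, 'm) ring_scheme \<Rightarrow> ('k, 'b, 'n) module_scheme \<Rightarrow> ('b \<Rightarrow> 'k) \<Rightarrow> bool" where
  "nondegenerate_trace K A tr \<longleftrightarrow>
    (\<forall>x\<in>carrier A. (\<forall>y\<in>carrier A. tr (x \<otimes>\<^bsub>A\<^esub> y) = \<zero>\<^bsub>K\<^esub>) \<longrightarrow> x = \<zero>\<^bsub>A\<^esub>) \<and>
    (\<forall>y\<in>carrier A. (\<forall>x\<in>carrier A. tr (x \<otimes>\<^bsub>A\<^esub> y) = \<zero>\<^bsub>K\<^esub>) \<longrightarrow> y = \<zero>\<^bsub>A\<^esub>)"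

definition symmetric_trace :: "('k, 'b, 'n) module_scheme \<Rightarrow> ('b \<Rightarrow> 'k) \<Rightarrow> bool" where
  "symmetric_trace A tr \<longleftrightarrow>
    (\<forall>x\<in>carrier A. \<forall>y\<in>carrier A. tr (x \<otimes>\<^bsub>A\<^esub> y) = tr (y \<otimes>\<^bsub>A\<^esub> x))"

definition homogeneous_trace ::
  "('k, 'm) ring_scheme \<Rightarrow> (nat \<Rightarrow> 'b set) \<Rightarrow> ('b \<Rightarrow> 'k) \<Rightarrow> bool" where
  "homogeneous_trace K G tr \<longleftrightarrow> (\<exists>d. \<forall>n. n \<noteq> d \<longrightarrow> (\<forall>x\<in>G n. tr x = \<zero>\<^bsub>K\<^esub>))"

definition graded_frobenius_algebra ::
  "('k, 'm) ring_scheme \<Rightarrow> ('k, 'b, 'n) module_scheme \<Rightarrow> (nat \<Rightarrow> 'b set) \<Rightarrow> bool" where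
  "graded_frobenius_algebra K A G \<longleftrightarrow>
    fin_dim_algebra K A \<and> graded_algebra K A G \<and>
    (\<exists>tr. trace_map K A tr \<and> nondegenerate_trace K A tr \<and> homogeneous_trace K G tr)"

definition graded_symmetric_algebra ::
  "('k, 'm) ring_scheme \<Rightarrow> ('k, 'b, 'n) module_scheme \<Rightarrow> (nat \<Rightarrow> 'b set) \<Rightarrow> bool" where
  "graded_symmetric_algebra K A G \<longleftrightarrow>
    fin_dim_algebra K A \<and> graded_algebra K A G \<and>
    (\<exists>tr. trace_map K A tr \<and> nondegenerate_trace K A tr \<and> symmetric_trace A tr \<and>
      homogeneous_trace K G tr)"


section \<open>Path algebras\<close>

text \<open>The quivers needed here have no parallel arrows, so a path is given by the list of its
  vertices, and the paths of a quiver are its \<^const>\<open>vwalk\<close>s (which are nonempty;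
  \<open>[a]\<close> is the trivial path at \<open>a\<close>).

  Elements are finitely supported coefficient functions on paths. A list \<open>r\<close> of length
  \<open>n\<close> arises from concatenating two paths, the end of the first being the start of the
  second, in exactly \<open>n\<close> ways, one for each position \<open>i\<close> at which the two paths meet;
  this is the index set in the multiplication. See \<open>path_elt_mult\<close> below.\<close>

definition path_algebra ::
  "('k, 'm) ring_scheme \<Rightarrow> 'a pair_pre_digraph \<Rightarrow> ('k, 'a list \<Rightarrow> 'k) module" where
  "path_algebra K Q =
    \<lparr>carrier = {f. (\<forall>p. f p \<in> carrier K) \<and> (\<forall>p. \<not> vwalk p Q \<longrightarrow> f p = \<zero>\<^bsub>K\<^esub>) \<and>
        finite {p. f p \<noteq> \<zero>\<^bsub>K\<^esub>}},
     mult = (\<lambda>f g r. \<Oplus>\<^bsub>K\<^esub>i\<in>{..<length r}. f (take (Suc i) r) \<otimes>\<^bsub>K\<^esub> g (drop i r)),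
     one = (\<lambda>p. if \<exists>a\<in>verts Q. p = [a] then \<one>\<^bsub>K\<^esub> else \<zero>\<^bsub>K\<^esub>),
     zero = (\<lambda>p. \<zero>\<^bsub>K\<^esub>),
     add = (\<lambda>f g p. f p \<oplus>\<^bsub>K\<^esub> g p),
     smult = (\<lambda>c f p. c \<otimes>\<^bsub>K\<^esub> f p)\<rparr>"

definition path_elt :: "('k, 'm) ring_scheme \<Rightarrow> 'a list \<Rightarrow> 'a list \<Rightarrow> 'k" where
  "path_elt K p = (\<lambda>q. if q = p then \<one>\<^bsub>K\<^esub> else \<zero>\<^bsub>K\<^esub>)"

lemma path_elt_mult:
  assumes "ring K" and "p \<noteq> []" and "q \<noteq> []"
  shows "path_elt K p \<otimes>\<^bsub>path_algebra K Q\<^esub> path_elt K q =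
    (if last p = hd q then path_elt K (p @ tl q) else \<zero>\<^bsub>path_algebra K Q\<^esub>)"
proof (rule ext)
  fix r
  interpret K: ring K by fact
  let ?i = "length p - 1"
  have iff: "take (Suc i) r = p \<and> drop i r = q \<longleftrightarrow>
      i = ?i \<and> last p = hd q \<and> r = p @ tl q" if "i < length r" for i
  proof
    assume h: "take (Suc i) r = p \<and> drop i r = q"
    have "length p = Suc i" using h that by auto
    moreover have "last p = r ! i"
      using h that by (metis last_snoc take_Suc_conv_app_nth)
    moreover have "hd q = r ! i" using h that by (metis hd_drop_conv_nth)
    moreover have "p @ tl q = r"
      using h by (metis append_take_drop_id drop_Suc tl_drop)
    ultimately show "i = ?i \<and> last p = hd q \<and> r = p @ tl q" by auto
  next
    assume h: "i = ?i \<and> last p = hd q \<and> r = p @ tl q"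
    have s: "Suc i = length p" using h assms(2) by (cases p) auto
    have "drop i p = [last p]"
      using s by (metis append_butlast_last_id append_eq_conv_conj assms(2) diff_Suc_1
          length_butlast)
    then have "drop i r = last p # tl q" using h s by simp
    then show "take (Suc i) r = p \<and> drop i r = q" using h s assms(3) by simp
  qed
  have "(path_elt K p \<otimes>\<^bsub>path_algebra K Q\<^esub> path_elt K q) r =
      (\<Oplus>\<^bsub>K\<^esub>i\<in>{..<length r}. if ?i = i
        then (if last p = hd q \<and> r = p @ tl q then \<one>\<^bsub>K\<^esub> else \<zero>\<^bsub>K\<^esub>) else \<zero>\<^bsub>K\<^esub>)"
  proof -
    have "path_elt K p (take (Suc i) r) \<otimes>\<^bsub>K\<^esub> path_elt K q (drop i r) = (if ?i = i
        then (if last p = hd q \<and> r = p @ tl q then \<one>\<^bsub>K\<^esub> else \<zero>\<^bsub>K\<^esub>) else \<zero>\<^bsub>K\<^esub>)"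
      if "i < length r" for i
    proof -
      have "path_elt K p (take (Suc i) r) \<otimes>\<^bsub>K\<^esub> path_elt K q (drop i r) =
          (if take (Suc i) r = p \<and> drop i r = q then \<one>\<^bsub>K\<^esub> else \<zero>\<^bsub>K\<^esub>)"
        by (simp add: path_elt_def)
      also have "\<dots> = (if i = ?i \<and> last p = hd q \<and> r = p @ tl q then \<one>\<^bsub>K\<^esub> else \<zero>\<^bsub>K\<^esub>)"
        by (simp only: iff[OF that])
      finally show ?thesis by auto
    qed
    then show ?thesis
      unfolding path_algebra_def monoid.simps by (intro K.add.finprod_cong') auto
  qed
  also have "\<dots> = (if last p = hd q \<and> r = p @ tl q then \<one>\<^bsub>K\<^esub> else \<zero>\<^bsub>K\<^esub>)"
  proof (cases "?i < length r")
    case True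
    then show ?thesis by (subst K.add.finprod_singleton) auto
  next
    case False
    then have "r \<noteq> p @ tl q" using assms(2) by (cases p) auto
    then show ?thesis by simp
  qed
  also have "\<dots> = (if last p = hd q then path_elt K (p @ tl q) else \<zero>\<^bsub>path_algebra K Q\<^esub>) r"
    by (simp add: path_elt_def path_algebra_def)
  finally show "(path_elt K p \<otimes>\<^bsub>path_algebra K Q\<^esub> path_elt K q) r =
    (if last p = hd q then path_elt K (p @ tl q) else \<zero>\<^bsub>path_algebra K Q\<^esub>) r" .
qed

text \<open>The quotient ring by a two-sided ideal, with \<open>c \<odot> (I + x) = I + c \<odot> x\<close>.\<close>

definition quot_algebra :: "('k, 'b, 'n) module_scheme \<Rightarrow> 'b set \<Rightarrow> ('k, 'b set) module" where
  "quot_algebra A I =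
    ring.extend (A Quot I) (module.fields (\<lambda>c X. \<Union>x\<in>X. I +>\<^bsub>A\<^esub> (c \<odot>\<^bsub>A\<^esub> x)))"


section \<open>Skew-zigzag algebras\<close>

definition simple_graph :: "'a set \<Rightarrow> 'a set set \<Rightarrow> bool" where
  "simple_graph V E \<longleftrightarrow> finite V \<and> (\<forall>e\<in>E. e \<subseteq> V \<and> card e = 2)"

definition double_quiver :: "'a set \<Rightarrow> 'a set set \<Rightarrow> 'a pair_pre_digraph" where
  "double_quiver V E = \<lparr>pverts = V, parcs = {(a, b). {a, b} \<in> E}\<rparr>"

text \<open>A graph is connected iff its double quiver is, in the sense of the library.\<close>

definition connected_graph :: "'a set \<Rightarrow> 'a set set \<Rightarrow> bool" where
  "connected_graph V E \<longleftrightarrow> Digraph_Component.connected (double_quiver V E)"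

definition skew_zigzag_coeffs ::
  "('k, 'm) ring_scheme \<Rightarrow> 'a set set \<Rightarrow> ('a \<Rightarrow> 'a \<Rightarrow> 'a \<Rightarrow> 'k) \<Rightarrow> bool" where
  "skew_zigzag_coeffs K E v \<longleftrightarrow>
    (\<forall>a b c. {a, b} \<in> E \<longrightarrow> {a, c} \<in> E \<longrightarrow> v a b c \<in> carrier K) \<and>
    (\<forall>a b. {a, b} \<in> E \<longrightarrow> v a b b = \<one>\<^bsub>K\<^esub>) \<and>
    (\<forall>a b c. {a, b} \<in> E \<longrightarrow> {a, c} \<in> E \<longrightarrow> v a b c \<otimes>\<^bsub>K\<^esub> v a c b = \<one>\<^bsub>K\<^esub>) \<and>
    (\<forall>a b c d. {a, b} \<in> E \<longrightarrow> {a, c} \<in> E \<longrightarrow> {a, d} \<in> E \<longrightarrow>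
      v a b c \<otimes>\<^bsub>K\<^esub> v a c d \<otimes>\<^bsub>K\<^esub> v a d b = \<one>\<^bsub>K\<^esub>)"

text \<open>If \<open>V\<close> is a single vertex \<open>a\<close>, the free algebra on one generator \<open>X\<close> is realised as the
  path algebra of the quiver with one loop \<open>X\<close> at \<open>a\<close>: the path \<open>[a]\<close> is \<open>1\<close>, the path
  \<open>[a, a]\<close> is \<open>X\<close>, and \<open>[a, a, a]\<close> is \<open>X\<^sup>2\<close>. As \<open>X\<close> has degree 2, a path then
  has twice its length as degree.\<close>

definition zigzag_quiver :: "'a set \<Rightarrow> 'a set set \<Rightarrow> 'a pair_pre_digraph" where
  "zigzag_quiver V E =
    (if card V = 1 then \<lparr>pverts = V, parcs = V \<times> V\<rparr> else double_quiver V E)"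

definition zigzag_path_degree :: "'a set \<Rightarrow> 'a list \<Rightarrow> nat" where
  "zigzag_path_degree V p = (if card V = 1 then 2 * vwalk_length p else vwalk_length p)"

definition skew_zigzag_relations ::
  "('k, 'm) ring_scheme \<Rightarrow> 'a set \<Rightarrow> 'a set set \<Rightarrow> ('a \<Rightarrow> 'a \<Rightarrow> 'a \<Rightarrow> 'k) \<Rightarrow>
    ('a list \<Rightarrow> 'k) set" where
  "skew_zigzag_relations K V E v =
    (let Q = zigzag_quiver V E; P = path_algebra K Q in
     if card V = 1 then {path_elt K [a, a, a] | a. a \<in> V}
     else if card V = 2 then {path_elt K p | p. vwalk p Q \<and> vwalk_length p > 2}
     else {path_elt K [a, b, c] | a b c. {a, b} \<in> E \<and> {b, c} \<in> E \<and> a \<noteq> c} \<union>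
       {path_elt K [a, b, a] \<ominus>\<^bsub>P\<^esub> v a b c \<odot>\<^bsub>P\<^esub> path_elt K [a, c, a] | a b c.
         {a, b} \<in> E \<and> {a, c} \<in> E})"

definition skew_zigzag_ideal ::
  "('k, 'm) ring_scheme \<Rightarrow> 'a set \<Rightarrow> 'a set set \<Rightarrow> ('a \<Rightarrow> 'a \<Rightarrow> 'a \<Rightarrow> 'k) \<Rightarrow>
    ('a list \<Rightarrow> 'k) set" where
  "skew_zigzag_ideal K V E v =
    Idl\<^bsub>path_algebra K (zigzag_quiver V E)\<^esub> (skew_zigzag_relations K V E v)"

definition skew_zigzag_algebra ::
  "('k, 'm) ring_scheme \<Rightarrow> 'a set \<Rightarrow> 'a set set \<Rightarrow> ('a \<Rightarrow> 'a \<Rightarrow> 'a \<Rightarrow> 'k) \<Rightarrow>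
    ('k, ('a list \<Rightarrow> 'k) set) module" where
  "skew_zigzag_algebra K V E v =
    quot_algebra (path_algebra K (zigzag_quiver V E)) (skew_zigzag_ideal K V E v)"

text \<open>The component of degree \<open>n\<close> is the image of the span of the paths of degree \<open>n\<close>.\<close>

definition skew_zigzag_component ::
  "('k, 'm) ring_scheme \<Rightarrow> 'a set \<Rightarrow> 'a set set \<Rightarrow> ('a \<Rightarrow> 'a \<Rightarrow> 'a \<Rightarrow> 'k) \<Rightarrow>
    nat \<Rightarrow> ('a list \<Rightarrow> 'k) set set" where
  "skew_zigzag_component K V E v n =
    (let P = path_algebra K (zigzag_quiver V E) in
     (\<lambda>f. skew_zigzag_ideal K V E v +>\<^bsub>P\<^esub> f) `
       {f \<in> carrier P. \<forall>p. f p \<noteq> \<zero>\<^bsub>K\<^esub> \<longrightarrow> zigzag_path_degree V p = n})"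

definition zigzag_algebra ::
  "('k, 'm) ring_scheme \<Rightarrow> 'a set \<Rightarrow> 'a set set \<Rightarrow> ('k, ('a list \<Rightarrow> 'k) set) module" where
  "zigzag_algebra K V E = skew_zigzag_algebra K V E (\<lambda>a b c. \<one>\<^bsub>K\<^esub>)"

definition zigzag_component ::
  "('k, 'm) ring_scheme \<Rightarrow> 'a set \<Rightarrow> 'a set set \<Rightarrow> nat \<Rightarrow> ('a list \<Rightarrow> 'k) set set" where
  "zigzag_component K V E = skew_zigzag_component K V E (\<lambda>a b c. \<one>\<^bsub>K\<^esub>)"

end

theory Submission
  imports Defs
begin

text \<open>Let \<open>\<Gamma>\<close> have at least two vertices, and choose a neighbour \<open>n a\<close> of every vertex \<open>a\<close>. Modulo the
  defining relations, a path \<open>(a|b|c)\<close> with \<open>a \<noteq> c\<close> is zero, \<open>(a|b|a)\<close> is a multiple of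
  \<open>(a|n a|a)\<close>, and all longer paths are zero. So the algebra is spanned by the vertices, the arrows
  and the paths \<open>(a|n a|a)\<close> (\<open>path_reduces_to_basis\<close>). Only the longer paths need an argument,
  and only for three or more vertices: if \<open>(x|y|x|y)\<close> is to survive, connectedness provides a third vertex adjacent to \<open>x\<close> or \<open>y\<close>, and
  replacing \<open>(x|y|x)\<close> or \<open>(y|x|y)\<close> by the closed path through that vertex produces a subpath
  \<open>(a|b|c)\<close> with \<open>a \<noteq> c\<close> (\<open>path_3_in_ideal\<close>).

  The trace is \<open>(a|b|a) \<mapsto> v\<^sup>a\<^sub>b\<^sub>,\<^sub>n\<^sub>a\<close>, and zero on all other paths. On the path algebra it is
  certainly defined; it descends to the quotient because \<open>tr (g x h) = 0\<close> for every relation \<open>x\<close>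
  and all \<open>g\<close>, \<open>h\<close> (\<open>socle_trace_relations\<close>), and here the cocycle condition on \<open>v\<close> enters. The
  spanning paths come in partners, whose product has nonzero trace: \<open>(a)\<close> and \<open>(a|n a|a)\<close>, and
  \<open>(a|b)\<close> and \<open>(b|a)\<close>; products of other spanning paths have trace zero. Hence an element whose
  pairings all vanish has zero coefficients on the spanning paths (\<open>nondegenerate_left\<close>,
  \<open>nondegenerate_right\<close>). If \<open>v = 1\<close>, then \<open>tr (p q) = tr (q p)\<close> on paths, so the trace is symmetric.

  The ideal itself is squeezed between the reduction of paths, which
  bounds it from below, and the vanishing of the trace, which bounds it from above; together they say
  that the ideal is the radical of the form \<open>tr (x y)\<close>. This principle is \<open>path_quotient_frobenius\<close>.
  The trace also yields the grading of the quotient. That the homogeneous components are independent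
  follows from homogeneity and nondegeneracy of the trace, because pairing with elements of degree
  \<open>m\<close> detects precisely the component of degree \<open>d - m\<close> (\<open>graded_algebraI_trace\<close>).

  For a single vertex the same principle applies with the spanning paths \<open>1\<close> and \<open>X\<close> and the trace
  that reads off the coefficient of \<open>X\<close>.\<close>

section \<open>Quotients of algebras with a grading and a trace\<close>

text \<open>The quotient algebra extends the record of the quotient ring by a scalar multiplication, so this
  transfers the ring axioms to it.\<close>

lemma ring_extend:
  assumes "ring R"
  shows "ring (ring.extend R m)"
proof -
  interpret ring R by fact
  show ?thesis
  proof (rule ringI)
    show "abelian_group (ring.extend R m)"
      by (rule abelian_groupI) (auto simp: ring.defs add.m_ac intro: add.l_inv_ex)
    show "Group.monoid (ring.extend R m)"
      by (rule monoidI) (auto simp: ring.defs m_assoc)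
  qed (auto simp: ring.defs l_distr r_distr)
qed

lemma (in unital_algebra) trace_map_finsum:
  assumes tr: "trace_map K A tr" and "finite S" and "F \<in> S \<rightarrow> carrier A"
  shows "tr (\<Oplus>\<^bsub>A\<^esub>s\<in>S. F s) = (\<Oplus>s\<in>S. tr (F s))"
  using assms(2,3)
proof (induction S rule: finite_induct)
  case empty
  have "tr (\<zero> \<odot>\<^bsub>A\<^esub> \<zero>\<^bsub>A\<^esub>) = \<zero> \<otimes> tr \<zero>\<^bsub>A\<^esub>" "tr \<zero>\<^bsub>A\<^esub> \<in> carrier K"
    using tr unfolding trace_map_def by blast+
  then show ?case by simp
next
  case (insert x S)
  have "tr (\<Oplus>\<^bsub>A\<^esub>s\<in>insert x S. F s) = tr (F x \<oplus>\<^bsub>A\<^esub> (\<Oplus>\<^bsub>A\<^esub>s\<in>S. F s))"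
    using insert by (subst M.finsum_insert) auto
  also have "\<dots> = tr (F x) \<oplus> tr (\<Oplus>\<^bsub>A\<^esub>s\<in>S. F s)"
    using insert tr unfolding trace_map_def by (simp add: Pi_def)
  also have "\<dots> = (\<Oplus>s\<in>insert x S. tr (F s))"
    using insert tr unfolding trace_map_def
    by (subst R.finsum_insert) (auto simp: Pi_def)
  finally show ?case .
qed

lemma (in unital_algebra) trace_map_minus:
  assumes tr: "trace_map K A tr" and "x \<in> carrier A" and "y \<in> carrier A"
  shows "tr (x \<ominus>\<^bsub>A\<^esub> y) = tr x \<ominus> tr y"
proof -
  have "x = (x \<ominus>\<^bsub>A\<^esub> y) \<oplus>\<^bsub>A\<^esub> y" using assms(2,3) by algebra
  then have "tr x = tr (x \<ominus>\<^bsub>A\<^esub> y) \<oplus> tr y"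
    using assms unfolding trace_map_def by (metis M.minus_closed)
  moreover have "tr (x \<ominus>\<^bsub>A\<^esub> y) \<in> carrier K" "tr y \<in> carrier K"
    using assms unfolding trace_map_def by auto
  ultimately show ?thesis by algebra
qed

lemma (in unital_algebra) trace_map_eqI:
  assumes "trace_map K A tr" and "x \<in> carrier A" and "y \<in> carrier A" and "tr (x \<ominus>\<^bsub>A\<^esub> y) = \<zero>"
  shows "tr x = tr y"
proof -
  have c: "tr x \<in> carrier K" "tr y \<in> carrier K"
    using assms unfolding trace_map_def by auto
  then have "tr x = (tr x \<ominus> tr y) \<oplus> tr y" by algebra
  then show ?thesis using trace_map_minus[OF assms(1-3)] assms(4) c(2)
    by (metis R.l_zero)
qed

lemma (in unital_algebra) trace_map_mult:
  assumes tr: "trace_map K A tr" and "y \<in> carrier A"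
  shows "trace_map K A (\<lambda>x. tr (x \<otimes>\<^bsub>A\<^esub> y))"
  using assms unfolding trace_map_def by (auto simp: A.l_distr smult_mult_left)

lemma (in unital_algebra) trace_map_mult_left:
  assumes tr: "trace_map K A tr" and "y \<in> carrier A"
  shows "trace_map K A (\<lambda>x. tr (y \<otimes>\<^bsub>A\<^esub> x))"
  using assms unfolding trace_map_def by (auto simp: A.r_distr smult_mult_right)

text \<open>The family \<open>g\<close> may hit an element of \<open>T\<close> several times. This matters for cosets: before
  linear independence is known, different spanning elements could have the same coset.\<close>

lemma (in unital_algebra) span_contains_finsum:
  assumes "finite T" and "T \<subseteq> carrier A" and "finite S" and "g \<in> S \<rightarrow> T" and "c \<in> S \<rightarrow> carrier K"
  shows "\<exists>d. (\<forall>t\<in>T. d t \<in> carrier K) \<and>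
    (\<Oplus>\<^bsub>A\<^esub>s\<in>S. c s \<odot>\<^bsub>A\<^esub> g s) = (\<Oplus>\<^bsub>A\<^esub>t\<in>T. d t \<odot>\<^bsub>A\<^esub> t)"
  using assms(3-5)
proof (induction S rule: finite_induct)
  case empty
  have "(\<Oplus>\<^bsub>A\<^esub>t\<in>T. \<zero> \<odot>\<^bsub>A\<^esub> t) = \<zero>\<^bsub>A\<^esub>"
    using assms(2) by (intro M.add.finprod_one_eqI) auto
  then show ?case by (intro exI[of _ "\<lambda>_. \<zero>"]) auto
next
  case (insert x S)
  then obtain d where d: "\<forall>t\<in>T. d t \<in> carrier K"
    "(\<Oplus>\<^bsub>A\<^esub>s\<in>S. c s \<odot>\<^bsub>A\<^esub> g s) = (\<Oplus>\<^bsub>A\<^esub>t\<in>T. d t \<odot>\<^bsub>A\<^esub> t)" by auto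
  define e where "e t = (if g x = t then c x else \<zero>)" for t
  have e: "e t \<in> carrier K" for t using insert by (auto simp: e_def)
  have gx: "g x \<in> T" and cx: "c x \<in> carrier K" using insert by auto
  have "(\<Oplus>\<^bsub>A\<^esub>s\<in>insert x S. c s \<odot>\<^bsub>A\<^esub> g s) = c x \<odot>\<^bsub>A\<^esub> g x \<oplus>\<^bsub>A\<^esub> (\<Oplus>\<^bsub>A\<^esub>t\<in>T. d t \<odot>\<^bsub>A\<^esub> t)"
    using insert assms(2) unfolding d(2)[symmetric]
    by (subst M.finsum_insert) (auto simp: Pi_def subset_iff)
  also have "c x \<odot>\<^bsub>A\<^esub> g x = (\<Oplus>\<^bsub>A\<^esub>t\<in>T. if g x = t then c x \<odot>\<^bsub>A\<^esub> t else \<zero>\<^bsub>A\<^esub>)"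
    using assms(2) gx cx by (subst M.finsum_singleton[OF gx assms(1)]) auto
  also have "\<dots> = (\<Oplus>\<^bsub>A\<^esub>t\<in>T. e t \<odot>\<^bsub>A\<^esub> t)"
    using assms(2) cx by (intro M.finsum_cong') (auto simp: e_def subset_iff)
  also have "(\<Oplus>\<^bsub>A\<^esub>t\<in>T. e t \<odot>\<^bsub>A\<^esub> t) \<oplus>\<^bsub>A\<^esub> (\<Oplus>\<^bsub>A\<^esub>t\<in>T. d t \<odot>\<^bsub>A\<^esub> t) =
      (\<Oplus>\<^bsub>A\<^esub>t\<in>T. e t \<odot>\<^bsub>A\<^esub> t \<oplus>\<^bsub>A\<^esub> d t \<odot>\<^bsub>A\<^esub> t)"
    using assms(2) d(1) e by (subst M.finsum_addf) (auto simp: subset_iff)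
  also have "\<dots> = (\<Oplus>\<^bsub>A\<^esub>t\<in>T. (e t \<oplus> d t) \<odot>\<^bsub>A\<^esub> t)"
    using assms(2) d(1) e by (intro M.finsum_cong') (auto simp: smult_l_distr subset_iff)
  finally show ?case using d(1) e by (intro exI[of _ "\<lambda>t. e t \<oplus> d t"]) auto
qed

lemma (in unital_algebra) trace_map_zero:
  assumes "trace_map K A tr"
  shows "tr \<zero>\<^bsub>A\<^esub> = \<zero>"
  using trace_map_finsum[OF assms, of "{}" undefined] by simp

text \<open>The elements \<open>x\<close> with \<open>tr (g x h) = 0\<close> for all \<open>g\<close>, \<open>h\<close> form the largest two-sided ideal on
  which the trace vanishes. So the generators of an ideal decide whether a trace descends to the
  quotient.\<close>

lemma (in unital_algebra) trace_vanishes_on_genideal: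
  assumes tr: "trace_map K A tr" and "S \<subseteq> carrier A"
    and van: "\<And>x g h. \<lbrakk>x \<in> S; g \<in> carrier A; h \<in> carrier A\<rbrakk> \<Longrightarrow> tr (g \<otimes>\<^bsub>A\<^esub> x \<otimes>\<^bsub>A\<^esub> h) = \<zero>"
    and x: "x \<in> Idl\<^bsub>A\<^esub> S"
  shows "tr x = \<zero>"
proof -
  define R where "R = {x \<in> carrier A. \<forall>g\<in>carrier A. \<forall>h\<in>carrier A. tr (g \<otimes>\<^bsub>A\<^esub> x \<otimes>\<^bsub>A\<^esub> h) = \<zero>}"
  have z: "tr \<zero>\<^bsub>A\<^esub> = \<zero>" by (rule trace_map_zero[OF tr])
  have "ideal R A"
  proof (rule idealI[OF A.ring_axioms])
    have "submodule R K A"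
    proof (rule submoduleI)
      fix x assume x: "x \<in> R"
      then show "\<ominus>\<^bsub>A\<^esub> x \<in> R"
      proof -
        have "tr (g \<otimes>\<^bsub>A\<^esub> \<ominus>\<^bsub>A\<^esub> x \<otimes>\<^bsub>A\<^esub> h) = \<zero>" if gh: "g \<in> carrier A" "h \<in> carrier A" for g h
        proof -
          have "g \<otimes>\<^bsub>A\<^esub> \<ominus>\<^bsub>A\<^esub> x \<otimes>\<^bsub>A\<^esub> h = g \<otimes>\<^bsub>A\<^esub> x \<otimes>\<^bsub>A\<^esub> (\<ominus>\<^bsub>A\<^esub> h)"
            using x gh by (simp add: R_def A.r_minus A.l_minus A.m_assoc)
          then show ?thesis using x gh by (simp add: R_def)
        qed
        then show ?thesis using x by (simp add: R_def)
      qed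
      fix c assume c: "c \<in> carrier K"
      show "c \<odot>\<^bsub>A\<^esub> x \<in> R"
        using x c tr by (auto simp: R_def smult_mult_left smult_mult_right trace_map_def)
    next
      fix x y assume "x \<in> R" "y \<in> R"
      then show "x \<oplus>\<^bsub>A\<^esub> y \<in> R"
        using tr by (auto simp: R_def A.l_distr A.r_distr trace_map_def)
    qed (auto simp: R_def z)
    then show "subgroup R (add_monoid A)" by (rule submodule.axioms(1))
    fix x y assume x: "x \<in> R" and y: "y \<in> carrier A"
    show "y \<otimes>\<^bsub>A\<^esub> x \<in> R"
      using x y by (auto simp: R_def simp flip: A.m_assoc)
    show "x \<otimes>\<^bsub>A\<^esub> y \<in> R"
      using x y by (auto simp: R_def A.m_assoc)
  qed
  moreover have "S \<subseteq> R" using assms(2) van by (auto simp: R_def)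
  ultimately have "Idl\<^bsub>A\<^esub> S \<subseteq> R" by (rule A.genideal_minimal)
  then have "x \<in> carrier A" "tr (\<one>\<^bsub>A\<^esub> \<otimes>\<^bsub>A\<^esub> x \<otimes>\<^bsub>A\<^esub> \<one>\<^bsub>A\<^esub>) = \<zero>" using x by (auto simp: R_def)
  then show ?thesis by simp
qed

locale algebra_ideal = unital_algebra K A + I: ideal I A
  for K (structure) and A (structure) and I
begin

abbreviation "QA \<equiv> quot_algebra A I"

lemma quot_carrier: "carrier QA = (+>\<^bsub>A\<^esub>) I ` carrier A"
  by (auto simp: quot_algebra_def ring.defs FactRing_def A_RCOSETS_def')

lemma quot_zero: "\<zero>\<^bsub>QA\<^esub> = I"
  by (simp add: quot_algebra_def ring.defs FactRing_def)

lemma quot_one: "\<one>\<^bsub>QA\<^esub> = I +>\<^bsub>A\<^esub> \<one>\<^bsub>A\<^esub>"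
  by (simp add: quot_algebra_def ring.defs FactRing_def)

lemma quot_add: "x \<in> carrier A \<Longrightarrow> y \<in> carrier A \<Longrightarrow>
    (I +>\<^bsub>A\<^esub> x) \<oplus>\<^bsub>QA\<^esub> (I +>\<^bsub>A\<^esub> y) = I +>\<^bsub>A\<^esub> (x \<oplus>\<^bsub>A\<^esub> y)"
  by (simp add: quot_algebra_def ring.defs FactRing_def I.a_rcos_sum)

lemma quot_mult: "x \<in> carrier A \<Longrightarrow> y \<in> carrier A \<Longrightarrow>
    (I +>\<^bsub>A\<^esub> x) \<otimes>\<^bsub>QA\<^esub> (I +>\<^bsub>A\<^esub> y) = I +>\<^bsub>A\<^esub> (x \<otimes>\<^bsub>A\<^esub> y)"
  by (simp add: quot_algebra_def ring.defs FactRing_def I.rcoset_mult_add)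

lemma coset_eq_iff: "x \<in> carrier A \<Longrightarrow> y \<in> carrier A \<Longrightarrow>
    I +>\<^bsub>A\<^esub> x = I +>\<^bsub>A\<^esub> y \<longleftrightarrow> x \<ominus>\<^bsub>A\<^esub> y \<in> I"
  using A.quotient_eq_iff_same_a_r_cos[OF I.is_ideal] by blast

lemma coset_eq_zero_iff: "x \<in> carrier A \<Longrightarrow> I +>\<^bsub>A\<^esub> x = \<zero>\<^bsub>QA\<^esub> \<longleftrightarrow> x \<in> I"
  unfolding quot_zero using I.rcos_const_imp_mem A.a_rcos_zero[OF I.is_ideal] by blast

lemma ideal_smult:
  assumes "c \<in> carrier K" and "x \<in> I"
  shows "c \<odot>\<^bsub>A\<^esub> x \<in> I"
proof -
  have x: "x \<in> carrier A" using assms(2) by (rule I.Icarr)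
  have "c \<odot>\<^bsub>A\<^esub> x = (c \<odot>\<^bsub>A\<^esub> \<one>\<^bsub>A\<^esub>) \<otimes>\<^bsub>A\<^esub> x"
    using assms(1) x by (simp add: smult_mult_left)
  then show ?thesis using assms by (simp add: I.I_l_closed)
qed

lemma smult_minus:
  assumes "c \<in> carrier K" and "x \<in> carrier A" and "y \<in> carrier A"
  shows "c \<odot>\<^bsub>A\<^esub> x \<ominus>\<^bsub>A\<^esub> c \<odot>\<^bsub>A\<^esub> y = c \<odot>\<^bsub>A\<^esub> (x \<ominus>\<^bsub>A\<^esub> y)"
  using assms by (simp add: a_minus_def smult_r_distr smult_r_minus)

lemma quot_smult:
  assumes "c \<in> carrier K" and "x \<in> carrier A"
  shows "c \<odot>\<^bsub>QA\<^esub> (I +>\<^bsub>A\<^esub> x) = I +>\<^bsub>A\<^esub> (c \<odot>\<^bsub>A\<^esub> x)"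
proof -
  have "I +>\<^bsub>A\<^esub> (c \<odot>\<^bsub>A\<^esub> y) = I +>\<^bsub>A\<^esub> (c \<odot>\<^bsub>A\<^esub> x)" if yx: "y \<in> I +>\<^bsub>A\<^esub> x" for y
  proof -
    obtain i where i: "i \<in> I" "y = i \<oplus>\<^bsub>A\<^esub> x" using yx by (auto simp: a_r_coset_def')
    then have y: "y \<in> carrier A" using assms(2) I.Icarr by simp
    have "y \<ominus>\<^bsub>A\<^esub> x = i" using i assms(2) I.Icarr
      by (simp add: a_minus_def M.add.m_assoc M.r_neg)
    then have "y \<ominus>\<^bsub>A\<^esub> x \<in> I" using i(1) by simp
    then show ?thesis using assms y by (simp add: coset_eq_iff smult_minus ideal_smult)
  qed
  moreover have "x \<in> I +>\<^bsub>A\<^esub> x" using assms(2) by (rule I.a_rcos_self)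
  ultimately have "(\<Union>y\<in>I +>\<^bsub>A\<^esub> x. I +>\<^bsub>A\<^esub> (c \<odot>\<^bsub>A\<^esub> y)) = I +>\<^bsub>A\<^esub> (c \<odot>\<^bsub>A\<^esub> x)"
    by blast
  then show ?thesis by (simp add: quot_algebra_def ring.defs module.defs)
qed

lemmas quot_simps = quot_one quot_add quot_mult quot_smult

sublocale quot: unital_algebra K QA
proof -
  have "ring QA" unfolding quot_algebra_def by (intro ring_extend I.quotient_is_ring)
  then interpret QA: ring QA .
  show "unital_algebra K QA"
    by unfold_locales (auto simp: quot_carrier quot_simps smult_l_distr smult_r_distr
        smult_assoc1 smult_mult_left smult_mult_right)
qed

lemma quot_inv:
  assumes "x \<in> carrier A"
  shows "\<ominus>\<^bsub>QA\<^esub> (I +>\<^bsub>A\<^esub> x) = I +>\<^bsub>A\<^esub> (\<ominus>\<^bsub>A\<^esub> x)"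
proof (rule quot.M.minus_equality)
  show "(I +>\<^bsub>A\<^esub> (\<ominus>\<^bsub>A\<^esub> x)) \<oplus>\<^bsub>QA\<^esub> (I +>\<^bsub>A\<^esub> x) = \<zero>\<^bsub>QA\<^esub>"
    using assms by (simp add: quot_add M.l_neg coset_eq_zero_iff)
qed (use assms in \<open>auto simp: quot_carrier\<close>)

lemma quot_finsum:
  assumes "finite S" and "F \<in> S \<rightarrow> carrier A"
  shows "(\<Oplus>\<^bsub>QA\<^esub>s\<in>S. I +>\<^bsub>A\<^esub> F s) = I +>\<^bsub>A\<^esub> (\<Oplus>\<^bsub>A\<^esub>s\<in>S. F s)"
  using assms
proof (induction S rule: finite_induct)
  case empty
  show ?case using coset_eq_zero_iff[of "\<zero>\<^bsub>A\<^esub>"] by simp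
next
  case (insert x S)
  then show ?case
    by (subst quot.M.finsum_insert) (auto simp: quot_carrier quot_add Pi_def)
qed

lemma quot_fin_dim:
  assumes "finite S" and "e \<in> S \<rightarrow> carrier A"
    and span: "\<And>x. x \<in> carrier A \<Longrightarrow> \<exists>c. (\<forall>s\<in>S. c s \<in> carrier K) \<and>
      x \<ominus>\<^bsub>A\<^esub> (\<Oplus>\<^bsub>A\<^esub>s\<in>S. c s \<odot>\<^bsub>A\<^esub> e s) \<in> I"
  shows "fin_dim_algebra K QA"
proof unfold_locales
  define T where "T = (\<lambda>s. I +>\<^bsub>A\<^esub> e s) ` S"
  have T: "finite T" "T \<subseteq> carrier QA" using assms(1,2) by (auto simp: T_def quot_carrier)
  have "\<exists>d. (\<forall>t\<in>T. d t \<in> carrier K) \<and> X = (\<Oplus>\<^bsub>QA\<^esub>t\<in>T. d t \<odot>\<^bsub>QA\<^esub> t)" if X: "X \<in> carrier QA" for X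
  proof -
    obtain x where x: "x \<in> carrier A" "X = I +>\<^bsub>A\<^esub> x" using X by (auto simp: quot_carrier)
    obtain c where c: "\<forall>s\<in>S. c s \<in> carrier K" "x \<ominus>\<^bsub>A\<^esub> (\<Oplus>\<^bsub>A\<^esub>s\<in>S. c s \<odot>\<^bsub>A\<^esub> e s) \<in> I"
      using span[OF x(1)] by blast
    have cl: "(\<lambda>s. c s \<odot>\<^bsub>A\<^esub> e s) \<in> S \<rightarrow> carrier A" using c(1) assms(2) by auto
    have "X = I +>\<^bsub>A\<^esub> (\<Oplus>\<^bsub>A\<^esub>s\<in>S. c s \<odot>\<^bsub>A\<^esub> e s)"
      using x c(2) cl by (simp add: coset_eq_iff)
    also have "\<dots> = (\<Oplus>\<^bsub>QA\<^esub>s\<in>S. I +>\<^bsub>A\<^esub> (c s \<odot>\<^bsub>A\<^esub> e s))"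
      by (rule quot_finsum[OF assms(1) cl, symmetric])
    also have "\<dots> = (\<Oplus>\<^bsub>QA\<^esub>s\<in>S. c s \<odot>\<^bsub>QA\<^esub> (I +>\<^bsub>A\<^esub> e s))"
      using c(1) assms(2) by (intro quot.M.finsum_cong') (auto simp: quot_smult quot_carrier Pi_def)
    finally show ?thesis
      using quot.span_contains_finsum[OF T assms(1), of "\<lambda>s. I +>\<^bsub>A\<^esub> e s" c] c(1)
      by (auto simp: T_def Pi_def)
  qed
  with T show "\<exists>B. finite B \<and> B \<subseteq> carrier QA \<and> (\<forall>x\<in>carrier QA. \<exists>c. (\<forall>b\<in>B. c b \<in> carrier K) \<and>
      x = (\<Oplus>\<^bsub>QA\<^esub>b\<in>B. c b \<odot>\<^bsub>QA\<^esub> b))"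
    by blast
qed

text \<open>The choice of the representative does not matter as soon as \<open>t\<close> vanishes on \<open>I\<close>.\<close>

definition quot_trace :: "('c \<Rightarrow> 'a) \<Rightarrow> 'c set \<Rightarrow> 'a" where
  "quot_trace t X = t (SOME x. x \<in> carrier A \<and> I +>\<^bsub>A\<^esub> x = X)"

lemma quot_trace_coset:
  assumes "trace_map K A t" and "\<And>x. x \<in> I \<Longrightarrow> t x = \<zero>" and "x \<in> carrier A"
  shows "quot_trace t (I +>\<^bsub>A\<^esub> x) = t x"
proof -
  define y where "y = (SOME y. y \<in> carrier A \<and> I +>\<^bsub>A\<^esub> y = I +>\<^bsub>A\<^esub> x)"
  have y: "y \<in> carrier A \<and> I +>\<^bsub>A\<^esub> y = I +>\<^bsub>A\<^esub> x"
    unfolding y_def by (rule someI[of _ x]) (use assms(3) in simp)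
  then have "y \<ominus>\<^bsub>A\<^esub> x \<in> I" using assms(3) coset_eq_iff by blast
  then have "t (y \<ominus>\<^bsub>A\<^esub> x) = \<zero>" by (rule assms(2))
  then have "t y = t x" using y assms(1,3) by (intro trace_map_eqI) auto
  then show ?thesis by (simp add: quot_trace_def y_def)
qed

end

text \<open>A homogeneous nondegenerate trace makes the decomposition into components unique: if the trace
  lives in degree \<open>d\<close>, then \<open>tr (x y)\<close> for \<open>y\<close> of degree \<open>m\<close> depends only on the component of \<open>x\<close> of
  degree \<open>d - m\<close>, and nondegeneracy recovers this component from these values.\<close>

lemma (in unital_algebra) graded_algebraI_trace:
  assumes sub: "\<And>n. submodule (G n) K A"
    and mult: "\<And>x y m n. \<lbrakk>x \<in> G m; y \<in> G n\<rbrakk> \<Longrightarrow> x \<otimes>\<^bsub>A\<^esub> y \<in> G (m + n)"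
    and sum: "\<And>x. x \<in> carrier A \<Longrightarrow>
      \<exists>S f. finite S \<and> (\<forall>n. f n \<in> G n) \<and> x = (\<Oplus>\<^bsub>A\<^esub>n\<in>S. f n)"
    and tr: "trace_map K A tr" and nondeg: "nondegenerate_trace K A tr"
    and hom: "homogeneous_trace K G tr"
  shows "graded_algebra K A G"
proof -
  have GA: "x \<in> carrier A" if "x \<in> G n" for x n
    using that submoduleE(1)[OF sub] by blast
  have G0: "\<zero>\<^bsub>A\<^esub> \<in> G n" for n
    using subgroup.one_closed[OF submodule.axioms(1)[OF sub]] by simp
  obtain d where d: "\<And>n x. n \<noteq> d \<Longrightarrow> x \<in> G n \<Longrightarrow> tr x = \<zero>"
    using hom unfolding homogeneous_trace_def by blast
  have trc: "tr x \<in> carrier K" if "x \<in> carrier A" for x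
    using tr that unfolding trace_map_def by blast
  let ?dec = "\<lambda>x f. (\<forall>n. f n \<in> G n) \<and> finite {n. f n \<noteq> \<zero>\<^bsub>A\<^esub>} \<and>
        x = (\<Oplus>\<^bsub>A\<^esub>n\<in>{n. f n \<noteq> \<zero>\<^bsub>A\<^esub>}. f n)"
  \<comment> \<open>pairing with \<open>G m\<close> sees only the component of degree \<open>d - m\<close>\<close>
  have comp: "tr (x \<otimes>\<^bsub>A\<^esub> y) = (if n + m = d then tr (f n \<otimes>\<^bsub>A\<^esub> y) else tr (x \<otimes>\<^bsub>A\<^esub> y))"
    if f: "?dec x f" and y: "y \<in> G m" for x f y m n
  proof (cases "n + m = d")
    case True
    let ?S = "insert n {n. f n \<noteq> \<zero>\<^bsub>A\<^esub>}"
    have fin: "finite ?S" using f by simp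
    have fc: "f k \<in> carrier A" for k using f GA by blast
    have yc: "y \<in> carrier A" using y GA by blast
    have "x = (\<Oplus>\<^bsub>A\<^esub>k\<in>{n. f n \<noteq> \<zero>\<^bsub>A\<^esub>}. f k)" using f by blast
    also have "\<dots> = (\<Oplus>\<^bsub>A\<^esub>k\<in>?S. f k)"
      using fc by (intro M.add.finprod_mono_neutral_cong_left[OF fin]) auto
    finally have x: "x = (\<Oplus>\<^bsub>A\<^esub>k\<in>?S. f k)" .
    have "tr (x \<otimes>\<^bsub>A\<^esub> y) = (\<Oplus>k\<in>?S. tr (f k \<otimes>\<^bsub>A\<^esub> y))"
      unfolding x using fc by (intro trace_map_finsum[OF trace_map_mult[OF tr yc] fin]) auto
    also have "\<dots> = (\<Oplus>k\<in>?S. if n = k then tr (f k \<otimes>\<^bsub>A\<^esub> y) else \<zero>)"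
    proof (intro R.finsum_cong')
      fix k assume "k \<in> ?S"
      have "f k \<otimes>\<^bsub>A\<^esub> y \<in> G (k + m)" using f y mult by blast
      then show "tr (f k \<otimes>\<^bsub>A\<^esub> y) = (if n = k then tr (f k \<otimes>\<^bsub>A\<^esub> y) else \<zero>)"
        using d[of "k + m"] True by auto
    qed (use fc yc trc in auto)
    also have "\<dots> = tr (f n \<otimes>\<^bsub>A\<^esub> y)"
      using fin fc yc trc by (subst R.finsum_singleton) auto
    finally show ?thesis using True by simp
  qed simp
  show ?thesis
  proof (intro graded_algebra.intro graded_algebra_axioms.intro unital_algebra_axioms sub mult)
    fix x assume x: "x \<in> carrier A"
    show "\<exists>!f. ?dec x f"
    proof (rule ex_ex1I)
      obtain S f where S: "finite S" "\<forall>n. f n \<in> G n" "x = (\<Oplus>\<^bsub>A\<^esub>n\<in>S. f n)"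
        using sum[OF x] by blast
      define g where "g n = (if n \<in> S then f n else \<zero>\<^bsub>A\<^esub>)" for n
      have sub: "{n. g n \<noteq> \<zero>\<^bsub>A\<^esub>} \<subseteq> S" by (auto simp: g_def)
      have fc: "f n \<in> carrier A" for n using S(2) GA by blast
      have "x = (\<Oplus>\<^bsub>A\<^esub>n\<in>{n. g n \<noteq> \<zero>\<^bsub>A\<^esub>}. g n)"
        unfolding S(3) using sub S(1) fc
        by (intro M.add.finprod_mono_neutral_cong_left[symmetric]) (auto simp: g_def)
      then have "?dec x g" using finite_subset[OF sub S(1)] S(2) G0 by (auto simp: g_def)
      then show "\<exists>f. ?dec x f" by blast
    next
      fix f g assume f: "?dec x f" and g: "?dec x g"
      show "f = g"
      proof
        fix n
        have c: "f n \<in> carrier A" "g n \<in> carrier A" using f g GA by blast+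
        have eq: "tr (f n \<otimes>\<^bsub>A\<^esub> y) = tr (g n \<otimes>\<^bsub>A\<^esub> y)" if y: "y \<in> G m" for y m
        proof (cases "n + m = d")
          case True
          then show ?thesis using comp[OF f y, of n] comp[OF g y, of n] by simp
        next
          case False
          then show ?thesis using d[OF False] mult f g y by metis
        qed
        have z: "tr ((f n \<ominus>\<^bsub>A\<^esub> g n) \<otimes>\<^bsub>A\<^esub> y) = \<zero>" if y: "y \<in> carrier A" for y
        proof -
          obtain S h where S: "finite S" "\<forall>k. h k \<in> G k" "y = (\<Oplus>\<^bsub>A\<^esub>k\<in>S. h k)"
            using sum[OF y] by blast
          have hc: "h k \<in> carrier A" for k using S(2) GA by blast
          have "tr (f n \<otimes>\<^bsub>A\<^esub> y) = (\<Oplus>k\<in>S. tr (f n \<otimes>\<^bsub>A\<^esub> h k))"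
            unfolding S(3) using S(1) hc c by (simp add: A.finsum_rdistr trace_map_finsum[OF tr] Pi_def)
          also have "\<dots> = (\<Oplus>k\<in>S. tr (g n \<otimes>\<^bsub>A\<^esub> h k))"
            using eq[OF S(2)[rule_format]] by simp
          also have "\<dots> = tr (g n \<otimes>\<^bsub>A\<^esub> y)"
            unfolding S(3) using S(1) hc c by (simp add: A.finsum_rdistr trace_map_finsum[OF tr] Pi_def)
          finally have "tr (f n \<otimes>\<^bsub>A\<^esub> y) = tr (g n \<otimes>\<^bsub>A\<^esub> y)" .
          then show ?thesis
            using trace_map_minus[OF trace_map_mult[OF tr y] c] c y trc by (simp add: a_minus_def R.r_neg)
        qed
        have "f n \<ominus>\<^bsub>A\<^esub> g n = \<zero>\<^bsub>A\<^esub>"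
          using nondeg z c unfolding nondegenerate_trace_def by (meson M.minus_closed)
        moreover have "f n = (f n \<ominus>\<^bsub>A\<^esub> g n) \<oplus>\<^bsub>A\<^esub> g n" using c by algebra
        ultimately show "f n = g n" using c(2) by (metis M.l_zero)
      qed
    qed
  qed
qed

context algebra_ideal
begin

lemma quot_submodule:
  assumes sub: "submodule H K A"
  shows "submodule ((+>\<^bsub>A\<^esub>) I ` H) K QA"
proof (rule quot.submoduleI)
  note H = submoduleE[OF sub]
  have c: "x \<in> carrier A" if "x \<in> H" for x using that H(1) by blast
  show "(+>\<^bsub>A\<^esub>) I ` H \<subseteq> carrier QA" using H(1) by (auto simp: quot_carrier)
  have "\<zero>\<^bsub>A\<^esub> \<in> H" using subgroup.one_closed[OF submodule.axioms(1)[OF sub]] by simp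
  then show "\<zero>\<^bsub>QA\<^esub> \<in> (+>\<^bsub>A\<^esub>) I ` H"
    using coset_eq_zero_iff[of "\<zero>\<^bsub>A\<^esub>"] by force
  show "\<ominus>\<^bsub>QA\<^esub> X \<in> (+>\<^bsub>A\<^esub>) I ` H" if "X \<in> (+>\<^bsub>A\<^esub>) I ` H" for X
    using that H(3) c by (auto simp: quot_inv)
  show "X \<oplus>\<^bsub>QA\<^esub> Y \<in> (+>\<^bsub>A\<^esub>) I ` H"
    if "X \<in> (+>\<^bsub>A\<^esub>) I ` H" "Y \<in> (+>\<^bsub>A\<^esub>) I ` H" for X Y
    using that H(5) c by (auto simp: quot_add)
  show "k \<odot>\<^bsub>QA\<^esub> X \<in> (+>\<^bsub>A\<^esub>) I ` H"
    if "k \<in> carrier K" "X \<in> (+>\<^bsub>A\<^esub>) I ` H" for k X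
    using that H(4) c by (auto simp: quot_smult)
qed

text \<open>A trace on \<open>A\<close> that vanishes on \<open>I\<close> induces a nondegenerate trace on \<open>A / I\<close> exactly when \<open>I\<close> is
  the left and the right radical of its form; the hypotheses \<open>left\<close> and \<open>right\<close> are the inclusions
  that do not hold automatically.\<close>

theorem quot_graded_trace:
  assumes gr: "graded_algebra K A G"
    and tr: "trace_map K A t"
    and van: "\<And>x. x \<in> I \<Longrightarrow> t x = \<zero>"
    and left: "\<And>x. \<lbrakk>x \<in> carrier A; \<And>y. y \<in> carrier A \<Longrightarrow> t (x \<otimes>\<^bsub>A\<^esub> y) = \<zero>\<rbrakk> \<Longrightarrow> x \<in> I"
    and right: "\<And>y. \<lbrakk>y \<in> carrier A; \<And>x. x \<in> carrier A \<Longrightarrow> t (x \<otimes>\<^bsub>A\<^esub> y) = \<zero>\<rbrakk> \<Longrightarrow> y \<in> I"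
    and hom: "homogeneous_trace K G t"
  defines "G' \<equiv> \<lambda>n. (+>\<^bsub>A\<^esub>) I ` G n"
  shows "graded_algebra K QA G'" and "trace_map K QA (quot_trace t)"
    and "nondegenerate_trace K QA (quot_trace t)" and "homogeneous_trace K G' (quot_trace t)"
    and "symmetric_trace A t \<Longrightarrow> symmetric_trace QA (quot_trace t)"
proof -
  interpret gr: graded_algebra K A G by fact
  note qt = quot_trace_coset[OF tr van]
  have GA: "x \<in> carrier A" if "x \<in> G n" for x n
    using that submoduleE(1)[OF gr.graded_submodule] by blast
  show t': "trace_map K QA (quot_trace t)"
    using tr unfolding trace_map_def by (auto simp: quot_carrier quot_add quot_smult qt)
  show nd: "nondegenerate_trace K QA (quot_trace t)"
  proof -
    have pair: "quot_trace t ((I +>\<^bsub>A\<^esub> x) \<otimes>\<^bsub>QA\<^esub> (I +>\<^bsub>A\<^esub> y)) = t (x \<otimes>\<^bsub>A\<^esub> y)"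
      if "x \<in> carrier A" "y \<in> carrier A" for x y
      using that by (simp add: quot_mult qt)
    have "I +>\<^bsub>A\<^esub> x = \<zero>\<^bsub>QA\<^esub>" if "x \<in> carrier A"
      "\<forall>y\<in>carrier A. quot_trace t ((I +>\<^bsub>A\<^esub> x) \<otimes>\<^bsub>QA\<^esub> (I +>\<^bsub>A\<^esub> y)) = \<zero>" for x
      using left[OF that(1)] pair that coset_eq_zero_iff[OF that(1)] by simp
    moreover have "I +>\<^bsub>A\<^esub> y = \<zero>\<^bsub>QA\<^esub>" if "y \<in> carrier A"
      "\<forall>x\<in>carrier A. quot_trace t ((I +>\<^bsub>A\<^esub> x) \<otimes>\<^bsub>QA\<^esub> (I +>\<^bsub>A\<^esub> y)) = \<zero>" for y
      using right[OF that(1)] pair that coset_eq_zero_iff[OF that(1)] by simp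
    ultimately show ?thesis unfolding nondegenerate_trace_def quot_carrier by blast
  qed
  show h': "homogeneous_trace K G' (quot_trace t)"
    using hom GA unfolding homogeneous_trace_def G'_def by (auto simp: qt)
  show "symmetric_trace A t \<Longrightarrow> symmetric_trace QA (quot_trace t)"
    unfolding symmetric_trace_def by (auto simp: quot_carrier quot_mult qt)
  show "graded_algebra K QA G'"
  proof (rule quot.graded_algebraI_trace[OF _ _ _ t' nd h'])
    show "submodule (G' n) K QA" for n
      unfolding G'_def by (rule quot_submodule[OF gr.graded_submodule])
    show "X \<otimes>\<^bsub>QA\<^esub> Y \<in> G' (m + n)" if "X \<in> G' m" "Y \<in> G' n" for X Y m n
      using that gr.graded_mult GA unfolding G'_def by (auto simp: quot_mult)
    show "\<exists>S f. finite S \<and> (\<forall>n. f n \<in> G' n) \<and> X = (\<Oplus>\<^bsub>QA\<^esub>n\<in>S. f n)" if X: "X \<in> carrier QA" for X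
    proof -
      obtain x where x: "x \<in> carrier A" "X = I +>\<^bsub>A\<^esub> x" using X by (auto simp: quot_carrier)
      obtain f where f: "\<forall>n. f n \<in> G n" "finite {n. f n \<noteq> \<zero>\<^bsub>A\<^esub>}"
        "x = (\<Oplus>\<^bsub>A\<^esub>n\<in>{n. f n \<noteq> \<zero>\<^bsub>A\<^esub>}. f n)"
        using gr.graded_direct_sum[OF x(1)] by blast
      have fc: "f \<in> {n. f n \<noteq> \<zero>\<^bsub>A\<^esub>} \<rightarrow> carrier A" using f(1) GA by blast
      have "X = (\<Oplus>\<^bsub>QA\<^esub>n\<in>{n. f n \<noteq> \<zero>\<^bsub>A\<^esub>}. I +>\<^bsub>A\<^esub> f n)"
        using quot_finsum[OF f(2) fc] unfolding x(2) f(3)[symmetric] by (rule sym)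
      moreover have "\<forall>n. I +>\<^bsub>A\<^esub> f n \<in> G' n" using f(1) by (simp add: G'_def)
      ultimately show ?thesis using f(2)
        by (intro exI[of _ "{n. f n \<noteq> \<zero>\<^bsub>A\<^esub>}"] exI[of _ "\<lambda>n. I +>\<^bsub>A\<^esub> f n"] conjI)
    qed
  qed
qed

end

text \<open>Modulo \<open>I\<close>, the factor \<open>x\<close> may be replaced by the multiple \<open>c y\<close>.\<close>

lemma (in algebra_ideal) mult_in_ideal_right:
  assumes "x \<in> carrier A" "y \<in> carrier A" "z \<in> carrier A" "c \<in> carrier K"
    and "x \<ominus>\<^bsub>A\<^esub> c \<odot>\<^bsub>A\<^esub> y \<in> I" and "y \<otimes>\<^bsub>A\<^esub> z \<in> I"
  shows "x \<otimes>\<^bsub>A\<^esub> z \<in> I"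
proof -
  have "x \<otimes>\<^bsub>A\<^esub> z = (x \<ominus>\<^bsub>A\<^esub> c \<odot>\<^bsub>A\<^esub> y) \<otimes>\<^bsub>A\<^esub> z \<oplus>\<^bsub>A\<^esub> c \<odot>\<^bsub>A\<^esub> (y \<otimes>\<^bsub>A\<^esub> z)"
    using assms(1-4) by (simp add: a_minus_def A.l_distr A.l_minus smult_mult_left M.a_assoc M.l_neg)
  then show ?thesis
    using assms by (simp add: I.I_r_closed ideal_smult I.a_closed)
qed

lemma (in algebra_ideal) mult_in_ideal_left:
  assumes "x \<in> carrier A" "y \<in> carrier A" "z \<in> carrier A" "c \<in> carrier K"
    and "x \<ominus>\<^bsub>A\<^esub> c \<odot>\<^bsub>A\<^esub> y \<in> I" and "z \<otimes>\<^bsub>A\<^esub> y \<in> I"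
  shows "z \<otimes>\<^bsub>A\<^esub> x \<in> I"
proof -
  have "z \<otimes>\<^bsub>A\<^esub> x = z \<otimes>\<^bsub>A\<^esub> (x \<ominus>\<^bsub>A\<^esub> c \<odot>\<^bsub>A\<^esub> y) \<oplus>\<^bsub>A\<^esub> c \<odot>\<^bsub>A\<^esub> (z \<otimes>\<^bsub>A\<^esub> y)"
    using assms(1-4) by (simp add: a_minus_def A.r_distr A.r_minus smult_mult_right M.a_assoc M.l_neg)
  then show ?thesis
    using assms by (simp add: I.I_l_closed ideal_smult I.a_closed)
qed

section \<open>Path algebras\<close>

lemma vwalk_take_drop:
  assumes "vwalk (take (Suc i) r) (with_proj Q)" and "vwalk (drop i r) (with_proj Q)"
  shows "vwalk r (with_proj Q)"
proof -
  have i: "i < length r" using assms(2) by (auto simp: vwalk_def)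
  have arcs: "vwalk_arcs r = vwalk_arcs (take (Suc i) r) @ vwalk_arcs (drop i r)"
    using i
  proof (induction r arbitrary: i rule: vwalk_arcs.induct)
    case (3 x y xs)
    then show ?case by (cases i) auto
  qed auto
  have "r = take (Suc i) r @ drop (Suc i) r" by simp
  then have "set r = set (take (Suc i) r) \<union> set (drop (Suc i) r)" by (metis set_append)
  moreover have "set (drop (Suc i) r) \<subseteq> set (drop i r)" by (simp add: set_drop_subset_set_drop)
  ultimately have "set r \<subseteq> pverts Q" using assms by (auto simp: vwalk_def)
  moreover have "set (vwalk_arcs r) \<subseteq> parcs Q" using assms unfolding arcs by (auto simp: vwalk_def)
  moreover have "r \<noteq> []" using i by auto
  ultimately show ?thesis by (simp add: vwalk_def)
qed

lemma path_elt_self: "path_elt K p p = \<one>\<^bsub>K\<^esub>"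
  by (simp add: path_elt_def)

lemma path_elt_other: "q \<noteq> p \<Longrightarrow> path_elt K p q = \<zero>\<^bsub>K\<^esub>"
  by (simp add: path_elt_def)

locale quiver_over_field = K: field K for K (structure) +
  fixes Q :: "'b pair_pre_digraph"
  assumes finite_verts: "finite (pverts Q)"
begin

abbreviation "P \<equiv> path_algebra K Q"

lemma P_carrier: "f \<in> carrier P \<longleftrightarrow> (\<forall>p. f p \<in> carrier K) \<and>
    (\<forall>p. \<not> vwalk p (with_proj Q) \<longrightarrow> f p = \<zero>) \<and> finite {p. f p \<noteq> \<zero>}"
  by (simp add: path_algebra_def)

lemma P_closed: "f \<in> carrier P \<Longrightarrow> f p \<in> carrier K"
  by (simp add: path_algebra_def)

lemma P_vwalk: "f \<in> carrier P \<Longrightarrow> f p \<noteq> \<zero> \<Longrightarrow> vwalk p (with_proj Q)"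
  by (auto simp: path_algebra_def)

lemma P_Nil: "f \<in> carrier P \<Longrightarrow> f [] = \<zero>"
  by (simp add: P_carrier vwalk_def)

lemma P_zero [simp]: "\<zero>\<^bsub>P\<^esub> p = \<zero>"
  by (simp add: path_algebra_def)

lemma P_add [simp]: "(f \<oplus>\<^bsub>P\<^esub> g) p = f p \<oplus> g p"
  by (simp add: path_algebra_def)

lemma P_smult [simp]: "(c \<odot>\<^bsub>P\<^esub> f) p = c \<otimes> f p"
  by (simp add: path_algebra_def)

lemma P_one: "\<one>\<^bsub>P\<^esub> p = (if \<exists>a\<in>pverts Q. p = [a] then \<one> else \<zero>)"
  by (simp add: path_algebra_def)

lemma P_mult: "(f \<otimes>\<^bsub>P\<^esub> g) r = (\<Oplus>i\<in>{..<length r}. f (take (Suc i) r) \<otimes> g (drop i r))"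
  by (simp add: path_algebra_def)

lemma P_mult_Nil [simp]: "(f \<otimes>\<^bsub>P\<^esub> g) [] = \<zero>"
  by (simp add: P_mult)

text \<open>The product splits off the meeting point at the first vertex. This recursion along the list turns
  associativity into an induction on the list, without any rearrangement of double sums.\<close>

lemma P_mult_Cons:
  assumes "\<And>p. f p \<in> carrier K" and "\<And>p. g p \<in> carrier K"
  shows "(f \<otimes>\<^bsub>P\<^esub> g) (a # r) = f [a] \<otimes> g (a # r) \<oplus> ((\<lambda>p. f (a # p)) \<otimes>\<^bsub>P\<^esub> g) r"
proof -
  have "(f \<otimes>\<^bsub>P\<^esub> g) (a # r) = (\<Oplus>i\<in>{..length r}. f (take (Suc i) (a # r)) \<otimes> g (drop i (a # r)))"
    by (simp add: P_mult lessThan_Suc_atMost)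
  also have "\<dots> = f [a] \<otimes> g (a # r) \<oplus> ((\<lambda>p. f (a # p)) \<otimes>\<^bsub>P\<^esub> g) r"
  proof (cases r)
    case Nil
    then show ?thesis using assms by (simp add: Pi_def)
  next
    case (Cons b s)
    then show ?thesis using assms
      by (simp add: P_mult Pi_def K.finsum_Suc2 K.add.m_comm lessThan_Suc_atMost del: K.finsum_Suc K.add.finprod_Suc)
  qed
  finally show ?thesis .
qed

lemma P_mult_closed_values:
  "(\<And>p. f p \<in> carrier K) \<Longrightarrow> (\<And>p. g p \<in> carrier K) \<Longrightarrow> (f \<otimes>\<^bsub>P\<^esub> g) r \<in> carrier K"
  by (auto simp: P_mult intro!: K.finsum_closed)

lemma P_mult_linear_left:
  assumes "\<And>p. f p \<in> carrier K" and "\<And>p. f' p \<in> carrier K" and "\<And>p. g p \<in> carrier K" and "c \<in> carrier K"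
  shows "((\<lambda>p. c \<otimes> f p \<oplus> f' p) \<otimes>\<^bsub>P\<^esub> g) r = c \<otimes> (f \<otimes>\<^bsub>P\<^esub> g) r \<oplus> (f' \<otimes>\<^bsub>P\<^esub> g) r"
  using assms
proof (induction r arbitrary: f f')
  case (Cons a r)
  let ?f = "\<lambda>p. f (a # p)" and ?f' = "\<lambda>p. f' (a # p)"
  have "(?f \<otimes>\<^bsub>P\<^esub> g) r \<in> carrier K" "(?f' \<otimes>\<^bsub>P\<^esub> g) r \<in> carrier K"
    using Cons.prems by (auto intro: P_mult_closed_values)
  then show ?case
    using Cons.prems by (simp add: P_mult_Cons Cons.IH) (simp add: K.l_distr K.r_distr K.add.m_ac K.m_assoc)
qed (simp add: P_mult)

text \<open>Stated for arbitrary coefficient functions, because the induction passes from \<open>f\<close> to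
  \<open>\<lambda>p. f (a # p)\<close>, which leaves the path algebra: it need not vanish on the empty list.\<close>

lemma P_mult_assoc_values:
  assumes "\<And>p. f p \<in> carrier K" and "\<And>p. g p \<in> carrier K" and "\<And>p. h p \<in> carrier K"
  shows "((f \<otimes>\<^bsub>P\<^esub> g) \<otimes>\<^bsub>P\<^esub> h) r = (f \<otimes>\<^bsub>P\<^esub> (g \<otimes>\<^bsub>P\<^esub> h)) r"
  using assms(1)
proof (induction r arbitrary: f)
  case (Cons a r)
  let ?f = "\<lambda>p. f (a # p)" and ?g = "\<lambda>p. g (a # p)"
  note cl = Cons.prems assms(2,3) P_mult_closed_values
  have "((f \<otimes>\<^bsub>P\<^esub> g) \<otimes>\<^bsub>P\<^esub> h) (a # r) =
      f [a] \<otimes> g [a] \<otimes> h (a # r) \<oplus> ((\<lambda>p. f [a] \<otimes> ?g p \<oplus> (?f \<otimes>\<^bsub>P\<^esub> g) p) \<otimes>\<^bsub>P\<^esub> h) r"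
    using cl by (simp add: P_mult_Cons)
  also have "\<dots> = f [a] \<otimes> g [a] \<otimes> h (a # r) \<oplus>
      (f [a] \<otimes> (?g \<otimes>\<^bsub>P\<^esub> h) r \<oplus> (?f \<otimes>\<^bsub>P\<^esub> (g \<otimes>\<^bsub>P\<^esub> h)) r)"
    using cl by (subst P_mult_linear_left) (simp_all add: Cons.IH)
  also have "\<dots> = (f \<otimes>\<^bsub>P\<^esub> (g \<otimes>\<^bsub>P\<^esub> h)) (a # r)"
  proof -
    have "(?g \<otimes>\<^bsub>P\<^esub> h) r \<in> carrier K" "(?f \<otimes>\<^bsub>P\<^esub> (g \<otimes>\<^bsub>P\<^esub> h)) r \<in> carrier K"
      using cl by (auto intro!: P_mult_closed_values)
    then show ?thesis using cl by (simp add: P_mult_Cons K.l_distr K.r_distr K.add.m_ac K.m_assoc)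
  qed
  finally show ?case .
qed simp

lemma P_add_closed: "f \<in> carrier P \<Longrightarrow> g \<in> carrier P \<Longrightarrow> f \<oplus>\<^bsub>P\<^esub> g \<in> carrier P"
proof -
  assume f: "f \<in> carrier P" and g: "g \<in> carrier P"
  have "{p. f p \<oplus> g p \<noteq> \<zero>} \<subseteq> {p. f p \<noteq> \<zero>} \<union> {p. g p \<noteq> \<zero>}"
    by auto
  then have "finite {p. f p \<oplus> g p \<noteq> \<zero>}"
    using f g unfolding P_carrier by (meson finite_UnI finite_subset)
  then show ?thesis using f g unfolding P_carrier by auto
qed

lemma P_smult_closed: "c \<in> carrier K \<Longrightarrow> f \<in> carrier P \<Longrightarrow> c \<odot>\<^bsub>P\<^esub> f \<in> carrier P"
proof -
  assume c: "c \<in> carrier K" and f: "f \<in> carrier P"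
  have "{p. c \<otimes> f p \<noteq> \<zero>} \<subseteq> {p. f p \<noteq> \<zero>}"
    using c by auto
  then have "finite {p. c \<otimes> f p \<noteq> \<zero>}"
    using f unfolding P_carrier by (meson finite_subset)
  then show ?thesis using c f unfolding P_carrier by auto
qed

lemma P_one_closed: "\<one>\<^bsub>P\<^esub> \<in> carrier P"
proof -
  have "{p. \<one>\<^bsub>P\<^esub> p \<noteq> \<zero>} \<subseteq> (\<lambda>a. [a]) ` pverts Q" by (auto simp: P_one)
  then have "finite {p. \<one>\<^bsub>P\<^esub> p \<noteq> \<zero>}" using finite_verts finite_surj by blast
  then show ?thesis unfolding P_carrier by (auto simp: P_one vwalk_def)
qed

lemma P_mult_nonzero:
  assumes "f \<in> carrier P" and "g \<in> carrier P" and "(f \<otimes>\<^bsub>P\<^esub> g) r \<noteq> \<zero>"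
  obtains i where "i < length r" and "f (take (Suc i) r) \<noteq> \<zero>" and "g (drop i r) \<noteq> \<zero>"
proof -
  have "\<exists>i<length r. f (take (Suc i) r) \<otimes> g (drop i r) \<noteq> \<zero>"
  proof (rule ccontr)
    assume "\<not> ?thesis"
    then have "(f \<otimes>\<^bsub>P\<^esub> g) r = \<zero>"
      unfolding P_mult by (intro K.add.finprod_one_eqI) simp
    then show False using assms(3) by simp
  qed
  then obtain i where i: "i < length r" "f (take (Suc i) r) \<otimes> g (drop i r) \<noteq> \<zero>" by blast
  moreover have "f (take (Suc i) r) \<noteq> \<zero>" using i(2) P_closed[OF assms(2)] by force
  moreover have "g (drop i r) \<noteq> \<zero>" using i(2) P_closed[OF assms(1)] by force
  ultimately show thesis using that by blast
qed

lemma P_mult_closed: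
  assumes f: "f \<in> carrier P" and g: "g \<in> carrier P"
  shows "f \<otimes>\<^bsub>P\<^esub> g \<in> carrier P"
proof -
  have "{r. (f \<otimes>\<^bsub>P\<^esub> g) r \<noteq> \<zero>} \<subseteq>
      (\<lambda>(p, q). p @ tl q) ` ({p. f p \<noteq> \<zero>} \<times> {q. g q \<noteq> \<zero>})"
  proof
    fix r assume "r \<in> {r. (f \<otimes>\<^bsub>P\<^esub> g) r \<noteq> \<zero>}"
    then obtain i where i: "f (take (Suc i) r) \<noteq> \<zero>" "g (drop i r) \<noteq> \<zero>"
      using P_mult_nonzero[OF f g] by blast
    have "r = take (Suc i) r @ tl (drop i r)"
      by (metis append_take_drop_id drop_Suc tl_drop)
    then show "r \<in> (\<lambda>(p, q). p @ tl q) ` ({p. f p \<noteq> \<zero>} \<times> {q. g q \<noteq> \<zero>})"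
      using i by (intro image_eqI[of _ _ "(take (Suc i) r, drop i r)"]) auto
  qed
  moreover have "finite ({p. f p \<noteq> \<zero>} \<times> {q. g q \<noteq> \<zero>})" using f g by (simp add: P_carrier)
  ultimately have "finite {r. (f \<otimes>\<^bsub>P\<^esub> g) r \<noteq> \<zero>}" using finite_surj by blast
  moreover have "(f \<otimes>\<^bsub>P\<^esub> g) r = \<zero>" if "\<not> vwalk r (with_proj Q)" for r
  proof (rule ccontr)
    assume "(f \<otimes>\<^bsub>P\<^esub> g) r \<noteq> \<zero>"
    then obtain i where i: "f (take (Suc i) r) \<noteq> \<zero>" "g (drop i r) \<noteq> \<zero>"
      using P_mult_nonzero[OF f g] by blast
    have "vwalk (take (Suc i) r) (with_proj Q)" "vwalk (drop i r) (with_proj Q)"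
      using i P_vwalk[OF f] P_vwalk[OF g] by blast+
    then show False using that vwalk_take_drop by blast
  qed
  moreover have "(f \<otimes>\<^bsub>P\<^esub> g) r \<in> carrier K" for r
    by (rule P_mult_closed_values[OF P_closed[OF f] P_closed[OF g]])
  ultimately show ?thesis unfolding P_carrier by blast
qed

lemma P_one_mult:
  assumes f: "f \<in> carrier P"
  shows "\<one>\<^bsub>P\<^esub> \<otimes>\<^bsub>P\<^esub> f = f"
proof
  fix r
  show "(\<one>\<^bsub>P\<^esub> \<otimes>\<^bsub>P\<^esub> f) r = f r"
  proof (cases r)
    case (Cons a s)
    have "((\<lambda>p. \<one>\<^bsub>P\<^esub> (a # p)) \<otimes>\<^bsub>P\<^esub> f) s = \<zero>"
      using P_closed[OF f] unfolding P_mult by (intro K.add.finprod_one_eqI) (auto simp: P_one)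
    moreover have "f (a # s) = \<zero>" if "a \<notin> pverts Q"
      using f that unfolding P_carrier by (auto simp: vwalk_def)
    ultimately show ?thesis
      using P_closed[OF f] P_closed[OF P_one_closed] by (simp add: Cons P_mult_Cons) (auto simp: P_one)
  qed (simp add: P_Nil[OF f])
qed

lemma P_mult_one:
  assumes f: "f \<in> carrier P"
  shows "f \<otimes>\<^bsub>P\<^esub> \<one>\<^bsub>P\<^esub> = f"
proof
  fix r
  show "(f \<otimes>\<^bsub>P\<^esub> \<one>\<^bsub>P\<^esub>) r = f r"
  proof (cases "r = []")
    case False
    let ?k = "length r - 1"
    have dr: "drop ?k r = [last r]" using False by (cases r rule: rev_cases) auto
    have "(f \<otimes>\<^bsub>P\<^esub> \<one>\<^bsub>P\<^esub>) r = (\<Oplus>i\<in>{..<length r}. if ?k = i then f (take (Suc i) r) \<otimes> \<one>\<^bsub>P\<^esub> (drop i r) else \<zero>)"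
      unfolding P_mult
    proof (rule K.finsum_cong')
      fix i assume i: "i \<in> {..<length r}"
      have "\<one>\<^bsub>P\<^esub> (drop i r) = \<zero>" if "i \<noteq> ?k"
      proof -
        have "drop i r \<noteq> [a]" for a
        proof
          assume "drop i r = [a]"
          then have "length (drop i r) = 1" by simp
          then show False using that i by simp
        qed
        then show ?thesis by (simp add: P_one)
      qed
      then show "f (take (Suc i) r) \<otimes> \<one>\<^bsub>P\<^esub> (drop i r) =
          (if ?k = i then f (take (Suc i) r) \<otimes> \<one>\<^bsub>P\<^esub> (drop i r) else \<zero>)"
        using P_closed[OF f] by auto
    qed (use P_closed[OF f] P_closed[OF P_one_closed] in auto)
    also have "\<dots> = f r \<otimes> \<one>\<^bsub>P\<^esub> [last r]"
      using False P_closed[OF f] P_closed[OF P_one_closed] dr by (subst K.finsum_singleton) auto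
    also have "\<dots> = f r"
    proof (cases "vwalk r (with_proj Q)")
      case True
      then have "last r \<in> pverts Q" using False by (auto simp: vwalk_def)
      then show ?thesis using P_closed[OF f] by (simp add: P_one)
    next
      case False
      then have "f r = \<zero>" using f by (simp add: P_carrier)
      then show ?thesis using P_closed[OF P_one_closed] by simp
    qed
    finally show ?thesis .
  qed (simp add: P_Nil[OF f])
qed

lemma P_abelian_group: "abelian_group P"
proof (rule abelian_groupI)
  show "\<zero>\<^bsub>P\<^esub> \<in> carrier P" by (simp add: P_carrier)
  show "\<exists>g\<in>carrier P. g \<oplus>\<^bsub>P\<^esub> f = \<zero>\<^bsub>P\<^esub>" if f: "f \<in> carrier P" for f
  proof
    show "(\<ominus> \<one>) \<odot>\<^bsub>P\<^esub> f \<in> carrier P" using f by (simp add: P_smult_closed)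
    show "(\<ominus> \<one>) \<odot>\<^bsub>P\<^esub> f \<oplus>\<^bsub>P\<^esub> f = \<zero>\<^bsub>P\<^esub>"
      using P_closed[OF f] by (auto simp: K.l_minus K.l_neg)
  qed
qed (auto simp: P_add_closed fun_eq_iff P_closed K.add.m_ac)

lemma P_distrib:
  assumes "f \<in> carrier P" "g \<in> carrier P" "h \<in> carrier P"
  shows "(f \<oplus>\<^bsub>P\<^esub> g) \<otimes>\<^bsub>P\<^esub> h = f \<otimes>\<^bsub>P\<^esub> h \<oplus>\<^bsub>P\<^esub> g \<otimes>\<^bsub>P\<^esub> h"
    and "h \<otimes>\<^bsub>P\<^esub> (f \<oplus>\<^bsub>P\<^esub> g) = h \<otimes>\<^bsub>P\<^esub> f \<oplus>\<^bsub>P\<^esub> h \<otimes>\<^bsub>P\<^esub> g"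
  using P_closed[OF assms(1)] P_closed[OF assms(2)] P_closed[OF assms(3)]
  by (auto simp: fun_eq_iff P_mult K.l_distr K.r_distr K.finsum_addf)

lemma P_assoc:
  assumes "f \<in> carrier P" "g \<in> carrier P" "h \<in> carrier P"
  shows "f \<otimes>\<^bsub>P\<^esub> g \<otimes>\<^bsub>P\<^esub> h = f \<otimes>\<^bsub>P\<^esub> (g \<otimes>\<^bsub>P\<^esub> h)"
  using P_mult_assoc_values[OF P_closed[OF assms(1)] P_closed[OF assms(2)] P_closed[OF assms(3)]]
  by (rule ext)

sublocale P: unital_algebra K P
proof -
  have "ring P"
    by (rule ringI[OF P_abelian_group])
      (auto intro!: monoidI P_mult_closed P_one_closed P_one_mult P_mult_one P_distrib P_assoc)
  then interpret P: ring P .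
  show "unital_algebra K P"
  proof unfold_locales
    fix c f g assume *: "c \<in> carrier K" "f \<in> carrier P" "g \<in> carrier P"
    note cl = *(1) P_closed[OF *(2)] P_closed[OF *(3)]
    show "c \<odot>\<^bsub>P\<^esub> f \<otimes>\<^bsub>P\<^esub> g = c \<odot>\<^bsub>P\<^esub> (f \<otimes>\<^bsub>P\<^esub> g)"
      using cl by (auto simp: fun_eq_iff P_mult K.finsum_rdistr K.m_assoc)
    show "f \<otimes>\<^bsub>P\<^esub> (c \<odot>\<^bsub>P\<^esub> g) = c \<odot>\<^bsub>P\<^esub> (f \<otimes>\<^bsub>P\<^esub> g)"
      using cl by (auto simp: fun_eq_iff P_mult K.finsum_rdistr K.m_lcomm)
  qed (auto simp: P_smult_closed fun_eq_iff P_closed K.l_distr K.r_distr K.m_assoc)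
qed

lemma P_uminus:
  assumes f: "f \<in> carrier P"
  shows "(\<ominus>\<^bsub>P\<^esub> f) p = \<ominus> f p"
proof -
  have "(\<ominus>\<^bsub>P\<^esub> f \<oplus>\<^bsub>P\<^esub> f) p = \<zero>" using f by (simp add: P.M.l_neg)
  then show ?thesis
    using K.minus_equality[of "(\<ominus>\<^bsub>P\<^esub> f) p" "f p"] P_closed[OF f] P_closed[of "\<ominus>\<^bsub>P\<^esub> f"] f by simp
qed

lemma P_finsum:
  assumes "finite S" and "F \<in> S \<rightarrow> carrier P"
  shows "(\<Oplus>\<^bsub>P\<^esub>s\<in>S. F s) p = (\<Oplus>s\<in>S. F s p)"
  using assms
proof (induction S rule: finite_induct)
  case (insert x S)
  have "F x p \<in> carrier K" "(\<lambda>s. F s p) \<in> S \<rightarrow> carrier K"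
    using insert.prems P_closed by auto
  then show ?case using insert
    by (simp add: P.M.finsum_insert K.finsum_insert Pi_def)
qed simp

lemma path_elt_in [simp, intro]:
  assumes "vwalk p (with_proj Q)"
  shows "path_elt K p \<in> carrier P"
proof -
  have "{q. path_elt K p q \<noteq> \<zero>} \<subseteq> {p}" by (auto simp: path_elt_def)
  then have "finite {q. path_elt K p q \<noteq> \<zero>}" using finite_subset by blast
  then show ?thesis using assms unfolding P_carrier by (auto simp: path_elt_def)
qed

lemma P_expand:
  assumes f: "f \<in> carrier P" and S: "finite S" "{p. f p \<noteq> \<zero>} \<subseteq> S"
    and walks: "\<And>p. p \<in> S \<Longrightarrow> vwalk p (with_proj Q)"
  shows "f = (\<Oplus>\<^bsub>P\<^esub>p\<in>S. f p \<odot>\<^bsub>P\<^esub> path_elt K p)"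
proof
  fix q
  have "(\<lambda>p. f p \<odot>\<^bsub>P\<^esub> path_elt K p) \<in> S \<rightarrow> carrier P"
    using walks P_closed[OF f] by (auto intro: P_smult_closed)
  then have "(\<Oplus>\<^bsub>P\<^esub>p\<in>S. f p \<odot>\<^bsub>P\<^esub> path_elt K p) q = (\<Oplus>p\<in>S. f p \<otimes> path_elt K p q)"
    using S(1) by (simp add: P_finsum)
  also have "\<dots> = (\<Oplus>p\<in>S. if q = p then f p else \<zero>)"
    using P_closed[OF f] by (intro K.finsum_cong') (auto simp: path_elt_def)
  also have "\<dots> = f q"
  proof (cases "q \<in> S")
    case True
    then show ?thesis using S(1) P_closed[OF f] by (subst K.finsum_singleton) auto
  next
    case False
    then have "(\<Oplus>p\<in>S. if q = p then f p else \<zero>) = \<zero>"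
      by (intro K.add.finprod_one_eqI) auto
    moreover have "f q = \<zero>" using False S(2) by blast
    ultimately show ?thesis by simp
  qed
  finally show "f q = (\<Oplus>\<^bsub>P\<^esub>p\<in>S. f p \<odot>\<^bsub>P\<^esub> path_elt K p) q" by simp
qed

lemma P_induct [consumes 1, case_names zero add]:
  assumes f: "f \<in> carrier P" and zero: "X \<zero>\<^bsub>P\<^esub>"
    and add: "\<And>c p f. \<lbrakk>c \<in> carrier K; vwalk p (with_proj Q); f \<in> carrier P; X f\<rbrakk> \<Longrightarrow>
      X (c \<odot>\<^bsub>P\<^esub> path_elt K p \<oplus>\<^bsub>P\<^esub> f)"
  shows "X f"
proof -
  let ?F = "\<lambda>p. f p \<odot>\<^bsub>P\<^esub> path_elt K p"
  have main: "X (\<Oplus>\<^bsub>P\<^esub>p\<in>S. ?F p)" if "finite S" "\<And>p. p \<in> S \<Longrightarrow> vwalk p (with_proj Q)" for S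
    using that
  proof (induction S rule: finite_induct)
    case empty
    show ?case unfolding P.M.finsum_empty by (rule zero)
  next
    case (insert x S)
    have cl: "?F \<in> insert x S \<rightarrow> carrier P"
      using insert.prems P_closed[OF f] by (auto intro: P_smult_closed)
    have "(\<Oplus>\<^bsub>P\<^esub>p\<in>insert x S. ?F p) = ?F x \<oplus>\<^bsub>P\<^esub> (\<Oplus>\<^bsub>P\<^esub>p\<in>S. ?F p)"
      using insert.hyps cl by (intro P.M.finsum_insert) auto
    moreover have "X (?F x \<oplus>\<^bsub>P\<^esub> (\<Oplus>\<^bsub>P\<^esub>p\<in>S. ?F p))"
      using insert.prems insert.IH cl P_closed[OF f] by (intro add P.M.finsum_closed) blast+
    ultimately show ?case by (simp only:)
  qed
  have "finite {p. f p \<noteq> \<zero>}" using f by (simp add: P_carrier)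
  then have eq: "f = (\<Oplus>\<^bsub>P\<^esub>p\<in>{p. f p \<noteq> \<zero>}. ?F p)"
    using P_vwalk[OF f] by (intro P_expand[OF f]) auto
  have "X (\<Oplus>\<^bsub>P\<^esub>p\<in>{p. f p \<noteq> \<zero>}. ?F p)"
    using \<open>finite _\<close> P_vwalk[OF f] by (intro main) auto
  then show ?thesis by (rule ssubst[of f _ X, OF eq])
qed

text \<open>The degree of a path is a parameter, because the loop of the one-vertex quiver has degree 2.\<close>

definition homogeneous :: "('b list \<Rightarrow> nat) \<Rightarrow> nat \<Rightarrow> ('b list \<Rightarrow> 'a) set" where
  "homogeneous deg n = {f \<in> carrier P. \<forall>p. f p \<noteq> \<zero> \<longrightarrow> deg p = n}"

lemma P_graded:
  assumes deg: "\<And>r i. i < length r \<Longrightarrow> deg (take (Suc i) r) + deg (drop i r) = deg r"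
  shows "graded_algebra K P (homogeneous deg)"
proof (intro graded_algebra.intro graded_algebra_axioms.intro P.unital_algebra_axioms)
  show "submodule (homogeneous deg n) K P" for n
  proof (rule P.submoduleI)
    fix f assume f: "f \<in> homogeneous deg n"
    show "\<ominus>\<^bsub>P\<^esub> f \<in> homogeneous deg n"
      using f by (auto simp: homogeneous_def P_uminus) (metis K.minus_zero)
    fix c assume "c \<in> carrier K"
    then show "c \<odot>\<^bsub>P\<^esub> f \<in> homogeneous deg n"
      using f by (auto simp: homogeneous_def P_smult_closed) (metis K.r_null)
  next
    fix f g assume "f \<in> homogeneous deg n" "g \<in> homogeneous deg n"
    then show "f \<oplus>\<^bsub>P\<^esub> g \<in> homogeneous deg n"
      by (auto simp: homogeneous_def P_add_closed) (metis K.r_zero K.zero_closed)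
  qed (auto simp: homogeneous_def)
  show "f \<otimes>\<^bsub>P\<^esub> g \<in> homogeneous deg (m + n)"
    if "f \<in> homogeneous deg m" "g \<in> homogeneous deg n" for f g m n
  proof -
    have f: "f \<in> carrier P" and g: "g \<in> carrier P" using that by (auto simp: homogeneous_def)
    have "deg r = m + n" if "(f \<otimes>\<^bsub>P\<^esub> g) r \<noteq> \<zero>" for r
    proof -
      obtain i where "i < length r" "f (take (Suc i) r) \<noteq> \<zero>" "g (drop i r) \<noteq> \<zero>"
        using P_mult_nonzero[OF f g \<open>_ \<noteq> \<zero>\<close>] .
      then show ?thesis
        using \<open>f \<in> homogeneous deg m\<close> \<open>g \<in> homogeneous deg n\<close> deg[of i r]
        by (auto simp: homogeneous_def)
    qed
    then show ?thesis using f g by (simp add: homogeneous_def P_mult_closed)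
  qed
  fix f assume f: "f \<in> carrier P"
  let ?dec = "\<lambda>F. (\<forall>n. F n \<in> homogeneous deg n) \<and> finite {n. F n \<noteq> \<zero>\<^bsub>P\<^esub>} \<and>
        f = (\<Oplus>\<^bsub>P\<^esub>n\<in>{n. F n \<noteq> \<zero>\<^bsub>P\<^esub>}. F n)"
  have eval: "(\<Oplus>\<^bsub>P\<^esub>n\<in>{n. F n \<noteq> \<zero>\<^bsub>P\<^esub>}. F n) p = F (deg p) p"
    if F: "\<forall>n. F n \<in> homogeneous deg n" and fin: "finite {n. F n \<noteq> \<zero>\<^bsub>P\<^esub>}" for F p
  proof -
    have cl: "F n \<in> carrier P" for n using F by (simp add: homogeneous_def)
    let ?S = "insert (deg p) {n. F n \<noteq> \<zero>\<^bsub>P\<^esub>}"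
    have "(\<Oplus>\<^bsub>P\<^esub>n\<in>{n. F n \<noteq> \<zero>\<^bsub>P\<^esub>}. F n) p = (\<Oplus>n\<in>{n. F n \<noteq> \<zero>\<^bsub>P\<^esub>}. F n p)"
      using cl fin by (intro P_finsum) auto
    also have "\<dots> = (\<Oplus>n\<in>?S. if deg p = n then F n p else \<zero>)"
    proof (rule K.add.finprod_mono_neutral_cong_left)
      show "F n p = (if deg p = n then F n p else \<zero>)" for n
        using F by (auto simp: homogeneous_def)
    qed (use fin P_closed[OF cl] in auto)
    also have "\<dots> = F (deg p) p"
      using fin P_closed[OF cl] by (subst K.finsum_singleton) auto
    finally show ?thesis .
  qed
  show "\<exists>!F. ?dec F"
  proof (rule ex_ex1I)
    define F where "F n p = (if deg p = n then f p else \<zero>)" for n p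
    have F: "F n \<in> homogeneous deg n" for n
    proof -
      have "{p. F n p \<noteq> \<zero>} \<subseteq> {p. f p \<noteq> \<zero>}" by (auto simp: F_def)
      then have "finite {p. F n p \<noteq> \<zero>}" using f finite_subset unfolding P_carrier by blast
      then show ?thesis using f by (auto simp: homogeneous_def P_carrier F_def)
    qed
    have "{n. F n \<noteq> \<zero>\<^bsub>P\<^esub>} \<subseteq> deg ` {p. f p \<noteq> \<zero>}"
    proof
      fix n assume "n \<in> {n. F n \<noteq> \<zero>\<^bsub>P\<^esub>}"
      then obtain p where "F n p \<noteq> \<zero>" by (auto simp: fun_eq_iff)
      then show "n \<in> deg ` {p. f p \<noteq> \<zero>}" by (auto simp: F_def split: if_splits)
    qed
    moreover have "finite (deg ` {p. f p \<noteq> \<zero>})" using f by (simp add: P_carrier)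
    ultimately have fin: "finite {n. F n \<noteq> \<zero>\<^bsub>P\<^esub>}" by (rule finite_subset)
    have "f = (\<Oplus>\<^bsub>P\<^esub>n\<in>{n. F n \<noteq> \<zero>\<^bsub>P\<^esub>}. F n)"
    proof
      fix p
      show "f p = (\<Oplus>\<^bsub>P\<^esub>n\<in>{n. F n \<noteq> \<zero>\<^bsub>P\<^esub>}. F n) p"
        using eval[of F p] F fin by (simp add: F_def)
    qed
    then show "\<exists>F. ?dec F" using F fin by blast
  next
    fix F H assume F: "?dec F" and H: "?dec H"
    have "F n p = H n p" for n p
    proof (cases "deg p = n")
      case True
      have "f p = F (deg p) p" using F eval[of F p] by metis
      moreover have "f p = H (deg p) p" using H eval[of H p] by metis
      ultimately show ?thesis using True by simp
    next
      case False
      have "F n \<in> homogeneous deg n" "H n \<in> homogeneous deg n" using F H by blast+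
      then have "F n p = \<zero>" "H n p = \<zero>" using False unfolding homogeneous_def by blast+
      then show ?thesis by simp
    qed
    then show "F = H" by (intro ext)
  qed
qed

text \<open>As default rewrite rules these would also expand sums in \<open>P\<close> that are not applied to a path, which
  hides the ring structure of \<open>P\<close>. From here on they are used by name only.\<close>

declare P_zero [simp del] P_add [simp del] P_smult [simp del]
lemmas P_eval = P_zero P_add P_smult

lemma path_elt_mult_P: "p \<noteq> [] \<Longrightarrow> q \<noteq> [] \<Longrightarrow> last p = hd q \<Longrightarrow>
    path_elt K p \<otimes>\<^bsub>P\<^esub> path_elt K q = path_elt K (p @ tl q)"
  using path_elt_mult[OF K.ring_axioms] by fastforce

lemma P_mult_1:
  assumes "f \<in> carrier P" and "g \<in> carrier P"
  shows "(f \<otimes>\<^bsub>P\<^esub> g) [a] = f [a] \<otimes> g [a]"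
  using P_closed[OF assms(1)] P_closed[OF assms(2)] by (simp add: P_mult_Cons)

lemma P_mult_2:
  assumes "f \<in> carrier P" and "g \<in> carrier P"
  shows "(f \<otimes>\<^bsub>P\<^esub> g) [a, b] = f [a] \<otimes> g [a, b] \<oplus> f [a, b] \<otimes> g [b]"
  using P_closed[OF assms(1)] P_closed[OF assms(2)] by (simp add: P_mult_Cons)

lemma P_mult_3:
  assumes "f \<in> carrier P" and "g \<in> carrier P"
  shows "(f \<otimes>\<^bsub>P\<^esub> g) [a, b, c] =
    f [a] \<otimes> g [a, b, c] \<oplus> f [a, b] \<otimes> g [b, c] \<oplus> f [a, b, c] \<otimes> g [c]"
  using P_closed[OF assms(1)] P_closed[OF assms(2)] by (simp add: P_mult_Cons K.a_assoc)

text \<open>If all terms of \<open>x\<close> have length at least two, then a path of length two can arise from \<open>g x h\<close> only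
  with trivial paths from \<open>g\<close> and \<open>h\<close>.\<close>

lemma P_sandwich_3:
  assumes g: "g \<in> carrier P" and x: "x \<in> carrier P" and h: "h \<in> carrier P"
    and short: "\<And>p. length p \<le> 2 \<Longrightarrow> x p = \<zero>"
  shows "(g \<otimes>\<^bsub>P\<^esub> x \<otimes>\<^bsub>P\<^esub> h) [a, b, c] = g [a] \<otimes> x [a, b, c] \<otimes> h [c]"
  using P_closed[OF g] P_closed[OF x] P_closed[OF h]
  by (simp add: P_mult_1 P_mult_2 P_mult_3 P_mult_closed g x h short)

text \<open>Let the paths in \<open>B\<close> span the quotient and let \<open>t\<close> be a trace that vanishes on \<open>I\<close>. An element \<open>x\<close>
  is congruent modulo \<open>I\<close> to a combination \<open>g\<close> of \<open>B\<close>, and \<open>x\<close> and \<open>g\<close> have the same pairings. So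
  nondegeneracy has to be tested only on such \<open>g\<close>, as in \<open>left\<close> and \<open>right\<close>: if all pairings
  vanish, then \<open>g = 0\<close> and therefore \<open>x \<in> I\<close>.\<close>

theorem path_quotient_frobenius:
  assumes I: "ideal I P"
    and deg: "\<And>r i. i < length r \<Longrightarrow> deg (take (Suc i) r) + deg (drop i r) = deg r"
    and B: "finite B" "\<And>p. p \<in> B \<Longrightarrow> vwalk p (with_proj Q)"
    and span: "\<And>p. vwalk p (with_proj Q) \<Longrightarrow> path_elt K p \<in> I \<or>
      (\<exists>b\<in>B. \<exists>c\<in>carrier K. path_elt K p \<ominus>\<^bsub>P\<^esub> c \<odot>\<^bsub>P\<^esub> path_elt K b \<in> I)"
    and t: "trace_map K P t" and van: "\<And>x. x \<in> I \<Longrightarrow> t x = \<zero>"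
    and hom: "homogeneous_trace K (homogeneous deg) t"
    and left: "\<And>g p. \<lbrakk>g \<in> carrier P; \<And>q. q \<notin> B \<Longrightarrow> g q = \<zero>;
      \<And>y. y \<in> carrier P \<Longrightarrow> t (g \<otimes>\<^bsub>P\<^esub> y) = \<zero>; p \<in> B\<rbrakk> \<Longrightarrow> g p = \<zero>"
    and right: "\<And>g p. \<lbrakk>g \<in> carrier P; \<And>q. q \<notin> B \<Longrightarrow> g q = \<zero>;
      \<And>y. y \<in> carrier P \<Longrightarrow> t (y \<otimes>\<^bsub>P\<^esub> g) = \<zero>; p \<in> B\<rbrakk> \<Longrightarrow> g p = \<zero>"
  shows "graded_frobenius_algebra K (quot_algebra P I) (\<lambda>n. (+>\<^bsub>P\<^esub>) I ` homogeneous deg n)"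
    and "symmetric_trace P t \<Longrightarrow>
      graded_symmetric_algebra K (quot_algebra P I) (\<lambda>n. (+>\<^bsub>P\<^esub>) I ` homogeneous deg n)"
proof -
  interpret I: ideal I P by fact
  interpret algebra_ideal K P I ..
  have normal_form: "\<exists>g\<in>carrier P. (\<forall>q. q \<notin> B \<longrightarrow> g q = \<zero>) \<and> f \<ominus>\<^bsub>P\<^esub> g \<in> I"
    if "f \<in> carrier P" for f
    using that
  proof (induction rule: P_induct)
    case zero
    have "\<zero>\<^bsub>P\<^esub> \<ominus>\<^bsub>P\<^esub> \<zero>\<^bsub>P\<^esub> \<in> I" by (simp add: a_minus_def)
    then show ?case using P_zero by blast
  next
    case (add c p f)
    then obtain g where g: "g \<in> carrier P" "\<forall>q. q \<notin> B \<longrightarrow> g q = \<zero>" "f \<ominus>\<^bsub>P\<^esub> g \<in> I" by blast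
    have p: "path_elt K p \<in> carrier P" using add by blast
    have "\<exists>h\<in>carrier P. (\<forall>q. q \<notin> B \<longrightarrow> h q = \<zero>) \<and> path_elt K p \<ominus>\<^bsub>P\<^esub> h \<in> I"
      using span[OF add(2)]
    proof (elim disjE bexE)
      assume "path_elt K p \<in> I"
      then have "path_elt K p \<ominus>\<^bsub>P\<^esub> \<zero>\<^bsub>P\<^esub> \<in> I" using p by (simp add: a_minus_def)
      then show ?thesis using P_zero by blast
    next
      fix b d assume b: "b \<in> B" "d \<in> carrier K" "path_elt K p \<ominus>\<^bsub>P\<^esub> d \<odot>\<^bsub>P\<^esub> path_elt K b \<in> I"
      show ?thesis
      proof (intro bexI conjI)
        show "d \<odot>\<^bsub>P\<^esub> path_elt K b \<in> carrier P" using b B(2) by (blast intro: P_smult_closed)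
        show "\<forall>q. q \<notin> B \<longrightarrow> (d \<odot>\<^bsub>P\<^esub> path_elt K b) q = \<zero>"
          using b by (auto simp: path_elt_def P_smult)
      qed (rule b(3))
    qed
    then obtain h where h: "h \<in> carrier P" "\<forall>q. q \<notin> B \<longrightarrow> h q = \<zero>" "path_elt K p \<ominus>\<^bsub>P\<^esub> h \<in> I" by blast
    have ch: "c \<odot>\<^bsub>P\<^esub> h \<in> carrier P" and cp: "c \<odot>\<^bsub>P\<^esub> path_elt K p \<in> carrier P"
      using add h p by (auto intro: P_smult_closed)
    have "(c \<odot>\<^bsub>P\<^esub> path_elt K p \<oplus>\<^bsub>P\<^esub> f) \<ominus>\<^bsub>P\<^esub> (c \<odot>\<^bsub>P\<^esub> h \<oplus>\<^bsub>P\<^esub> g) =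
        (c \<odot>\<^bsub>P\<^esub> path_elt K p \<ominus>\<^bsub>P\<^esub> c \<odot>\<^bsub>P\<^esub> h) \<oplus>\<^bsub>P\<^esub> (f \<ominus>\<^bsub>P\<^esub> g)"
      using ch cp add(3) g(1) by (simp only: a_minus_def P.M.minus_add P.M.a_ac P.M.add.inv_closed P.M.add.m_closed P.M.a_inv_closed)
    also have "\<dots> = c \<odot>\<^bsub>P\<^esub> (path_elt K p \<ominus>\<^bsub>P\<^esub> h) \<oplus>\<^bsub>P\<^esub> (f \<ominus>\<^bsub>P\<^esub> g)"
      by (simp only: smult_minus[OF add(1) p h(1)])
    also have "\<dots> \<in> I"
      by (intro I.a_closed ideal_smult add(1) h(3) g(3))
    finally have "(c \<odot>\<^bsub>P\<^esub> path_elt K p \<oplus>\<^bsub>P\<^esub> f) \<ominus>\<^bsub>P\<^esub> (c \<odot>\<^bsub>P\<^esub> h \<oplus>\<^bsub>P\<^esub> g) \<in> I" .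
    moreover have "\<forall>q. q \<notin> B \<longrightarrow> (c \<odot>\<^bsub>P\<^esub> h \<oplus>\<^bsub>P\<^esub> g) q = \<zero>"
      using g(2) h(2) add(1) by (simp add: P_eval)
    ultimately show ?case using P_add_closed[OF ch g(1)] by blast
  qed
  have fd: "fin_dim_algebra K (quot_algebra P I)"
  proof (rule quot_fin_dim[OF B(1)])
    show "path_elt K \<in> B \<rightarrow> carrier P" using B(2) by blast
    fix x assume "x \<in> carrier P"
    then obtain g where g: "g \<in> carrier P" "\<forall>q. q \<notin> B \<longrightarrow> g q = \<zero>" "x \<ominus>\<^bsub>P\<^esub> g \<in> I"
      using normal_form by blast
    have "g = (\<Oplus>\<^bsub>P\<^esub>s\<in>B. g s \<odot>\<^bsub>P\<^esub> path_elt K s)"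
      using g(2) by (intro P_expand[OF g(1) B(1) _ B(2)]) auto
    then show "\<exists>c. (\<forall>s\<in>B. c s \<in> carrier K) \<and>
        x \<ominus>\<^bsub>P\<^esub> (\<Oplus>\<^bsub>P\<^esub>s\<in>B. c s \<odot>\<^bsub>P\<^esub> path_elt K s) \<in> I"
      using g(3) P_closed[OF g(1)] by (intro exI[of _ g]) simp
  qed
  have left': "x \<in> I"
    if x: "x \<in> carrier P" and zero: "\<And>y. y \<in> carrier P \<Longrightarrow> t (x \<otimes>\<^bsub>P\<^esub> y) = \<zero>" for x
  proof -
    obtain g where g: "g \<in> carrier P" "\<forall>q. q \<notin> B \<longrightarrow> g q = \<zero>" "x \<ominus>\<^bsub>P\<^esub> g \<in> I"
      using normal_form[OF x] by blast
    have "t (g \<otimes>\<^bsub>P\<^esub> y) = \<zero>" if y: "y \<in> carrier P" for y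
    proof -
      have "t ((x \<ominus>\<^bsub>P\<^esub> g) \<otimes>\<^bsub>P\<^esub> y) = \<zero>" using g(3) y by (intro van I.I_r_closed)
      then show ?thesis
        using P.trace_map_eqI[OF P.trace_map_mult[OF t y] x g(1)] zero[OF y] by simp
    qed
    then have "g p = \<zero>" for p using left[OF g(1)] g(2) by blast
    then have "g = \<zero>\<^bsub>P\<^esub>" by (simp add: fun_eq_iff P_zero)
    then show ?thesis using g(3) x by (simp add: a_minus_def)
  qed
  have right': "x \<in> I"
    if x: "x \<in> carrier P" and zero: "\<And>y. y \<in> carrier P \<Longrightarrow> t (y \<otimes>\<^bsub>P\<^esub> x) = \<zero>" for x
  proof -
    obtain g where g: "g \<in> carrier P" "\<forall>q. q \<notin> B \<longrightarrow> g q = \<zero>" "x \<ominus>\<^bsub>P\<^esub> g \<in> I"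
      using normal_form[OF x] by blast
    have "t (y \<otimes>\<^bsub>P\<^esub> g) = \<zero>" if y: "y \<in> carrier P" for y
    proof -
      have "t (y \<otimes>\<^bsub>P\<^esub> (x \<ominus>\<^bsub>P\<^esub> g)) = \<zero>" using g(3) y by (intro van I.I_l_closed)
      then show ?thesis
        using P.trace_map_eqI[OF P.trace_map_mult_left[OF t y] x g(1)] zero[OF y] by simp
    qed
    then have "g p = \<zero>" for p using right[OF g(1)] g(2) by blast
    then have "g = \<zero>\<^bsub>P\<^esub>" by (simp add: fun_eq_iff P_zero)
    then show ?thesis using g(3) x by (simp add: a_minus_def)
  qed
  have tr: "graded_algebra K QA (\<lambda>n. (+>\<^bsub>P\<^esub>) I ` homogeneous deg n)"
    "trace_map K QA (quot_trace t)" "nondegenerate_trace K QA (quot_trace t)"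
    "homogeneous_trace K (\<lambda>n. (+>\<^bsub>P\<^esub>) I ` homogeneous deg n) (quot_trace t)"
    by (rule quot_graded_trace[OF P_graded[of deg, OF deg] t van left' right' hom]; assumption)+
  show "graded_frobenius_algebra K QA (\<lambda>n. (+>\<^bsub>P\<^esub>) I ` homogeneous deg n)"
    unfolding graded_frobenius_algebra_def using fd tr by blast
  assume sym: "symmetric_trace P t"
  have "symmetric_trace QA (quot_trace t)"
    by (rule quot_graded_trace(5)[OF P_graded[of deg, OF deg] t van left' right' hom sym]; assumption)
  then show "graded_symmetric_algebra K QA (\<lambda>n. (+>\<^bsub>P\<^esub>) I ` homogeneous deg n)"
    unfolding graded_symmetric_algebra_def using fd tr by blast
qed

end

section \<open>Graphs with at least two vertices\<close>

locale skew_zigzag_graph = K: field K for K (structure) +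
  fixes V :: "'b set" and E :: "'b set set" and v :: "'b \<Rightarrow> 'b \<Rightarrow> 'b \<Rightarrow> 'a"
  assumes simple: "simple_graph V E"
    and connected: "connected_graph V E"
    and coeffs: "skew_zigzag_coeffs K E v"
    and two_verts: "card V \<ge> 2"
begin

lemma edgeD:
  assumes "{a, b} \<in> E"
  shows "a \<in> V" and "b \<in> V" and "a \<noteq> b" and "{b, a} \<in> E"
  using assms simple by (auto simp: simple_graph_def insert_commute dest!: bspec)

lemma finite_V: "finite V"
  using simple by (simp add: simple_graph_def)

text \<open>Otherwise no vertex outside \<open>S\<close> could be reached from \<open>S\<close>. Both consequences of connectedness that
  are needed come from here: every vertex has a neighbour (\<open>S = {a}\<close>), and if there is a third vertex,
  some vertex outside an edge is adjacent to it (\<open>S = {x, y}\<close>).\<close>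

lemma exit_edge:
  assumes S: "S \<subseteq> V" "S \<noteq> {}" "S \<noteq> V"
  obtains a c where "a \<in> S" and "c \<in> V - S" and "{a, c} \<in> E"
proof -
  let ?G = "mk_symmetric (with_proj (double_quiver V E))"
  obtain u w where u: "u \<in> S" and w: "w \<in> V - S" using S by blast
  have "u \<rightarrow>\<^sup>*\<^bsub>with_proj ?G\<^esub> w"
    using connected u w S(1)
    by (auto simp: connected_graph_def Digraph_Component.connected_def strongly_connected_def double_quiver_def)
  then have "(u, w) \<in> (arcs_ends (with_proj ?G))\<^sup>*"
    unfolding reachable_def by (rule rtrancl_on_rtranclI)
  moreover have arcs: "{a, c} \<in> E" if "(a, c) \<in> arcs_ends (with_proj ?G)" for a c
    using that by (auto simp: parcs_mk_symmetric double_quiver_def insert_commute)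
  have "w \<in> S" if no: "\<And>a c. a \<in> S \<Longrightarrow> c \<in> V - S \<Longrightarrow> {a, c} \<notin> E"
    using \<open>(u, w) \<in> _\<close>
  proof (induction rule: rtrancl_induct)
    case (step x y)
    then show ?case using no[of x y] arcs[of x y] edgeD(2)[of x y] by blast
  qed (rule u)
  then show thesis using w that by blast
qed

sublocale quiver_over_field K "double_quiver V E"
  by unfold_locales (simp add: double_quiver_def finite_V)

lemma vwalk_simps [simp]:
  "vwalk [a] (with_proj (double_quiver V E)) \<longleftrightarrow> a \<in> V"
  "vwalk (a # b # p) (with_proj (double_quiver V E)) \<longleftrightarrow>
    {a, b} \<in> E \<and> vwalk (b # p) (with_proj (double_quiver V E))"
  using edgeD by (auto simp: vwalk_def double_quiver_def)

lemma not_vwalk_Nil [simp]: "\<not> vwalk [] (with_proj (double_quiver V E))"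
  by (simp add: vwalk_def)

text \<open>An arbitrary neighbour, which serves as base point for the coefficients at \<open>a\<close>.\<close>

definition nbr :: "'b \<Rightarrow> 'b" where
  "nbr a = (SOME b. {a, b} \<in> E)"

lemma nbr: "a \<in> V \<Longrightarrow> {a, nbr a} \<in> E"
proof -
  assume a: "a \<in> V"
  have "card {a} \<noteq> card V" using two_verts by simp
  then have "{a} \<noteq> V" by metis
  then obtain c where "{a, c} \<in> E" using exit_edge[of "{a}"] a by blast
  then show ?thesis unfolding nbr_def by (rule someI)
qed

text \<open>In the quotient, \<open>[a, b, a]\<close> equals \<open>wt a b\<close> times \<open>[a, nbr a, a]\<close>.\<close>

definition wt :: "'b \<Rightarrow> 'b \<Rightarrow> 'a" where
  "wt a b = v a b (nbr a)"

lemma wt_closed: "{a, b} \<in> E \<Longrightarrow> wt a b \<in> carrier K"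
  using coeffs nbr[of a] edgeD(1)[of a b] by (auto simp: skew_zigzag_coeffs_def wt_def)

lemma wt_nonzero: "{a, b} \<in> E \<Longrightarrow> wt a b \<noteq> \<zero>"
proof
  assume ab: "{a, b} \<in> E" and z: "wt a b = \<zero>"
  have "wt a b \<otimes> v a (nbr a) b = \<one>" "v a (nbr a) b \<in> carrier K"
    using coeffs ab nbr[of a] edgeD(1)[OF ab] by (auto simp: skew_zigzag_coeffs_def wt_def)
  then show False using z by simp
qed

text \<open>This is the cocycle condition for \<open>b\<close>, \<open>c\<close>, \<open>nbr a\<close>. It makes \<open>wt\<close> compatible with the relation
  between \<open>[a, b, a]\<close> and \<open>[a, c, a]\<close>.\<close>

lemma wt_change:
  assumes ab: "{a, b} \<in> E" and ac: "{a, c} \<in> E"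
  shows "wt a b = v a b c \<otimes> wt a c"
proof -
  have n: "{a, nbr a} \<in> E" using nbr edgeD(1)[OF ab] .
  have cl: "v a b c \<in> carrier K" "v a c (nbr a) \<in> carrier K" "v a (nbr a) b \<in> carrier K" "v a b (nbr a) \<in> carrier K"
    using coeffs ab ac n by (auto simp: skew_zigzag_coeffs_def)
  have 1: "v a b c \<otimes> v a c (nbr a) \<otimes> v a (nbr a) b = \<one>"
    and 2: "v a (nbr a) b \<otimes> v a b (nbr a) = \<one>"
    using coeffs ab ac n by (auto simp: skew_zigzag_coeffs_def)
  have "v a b c \<otimes> v a c (nbr a) = v a b c \<otimes> v a c (nbr a) \<otimes> (v a (nbr a) b \<otimes> v a b (nbr a))"
    using cl unfolding 2 by simp
  also have "\<dots> = (v a b c \<otimes> v a c (nbr a) \<otimes> v a (nbr a) b) \<otimes> v a b (nbr a)"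
    using cl by (simp add: K.m_assoc)
  also have "\<dots> = v a b (nbr a)" using cl unfolding 1 by simp
  finally show ?thesis by (simp add: wt_def)
qed

definition edge_pairs :: "('b \<times> 'b) set" where
  "edge_pairs = {(a, b). {a, b} \<in> E}"

lemma finite_edge_pairs: "finite edge_pairs"
proof (rule finite_subset)
  show "edge_pairs \<subseteq> V \<times> V" using edgeD by (auto simp: edge_pairs_def)
qed (simp add: finite_V)

text \<open>The sum over all \<open>a\<close> of the coefficient of \<open>[a, nbr a, a]\<close>, once every closed path of length two
  has been expressed through these.\<close>

definition socle_trace :: "('b list \<Rightarrow> 'a) \<Rightarrow> 'a" where
  "socle_trace f = (\<Oplus>e\<in>edge_pairs. case e of (a, b) \<Rightarrow> wt a b \<otimes> f [a, b, a])"

lemma socle_trace_closed: "f \<in> carrier P \<Longrightarrow> socle_trace f \<in> carrier K"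
  unfolding socle_trace_def using P_closed wt_closed
  by (intro K.finsum_closed) (auto simp: edge_pairs_def)

lemma trace_map_socle_trace: "trace_map K P socle_trace"
  unfolding trace_map_def
proof (intro conjI ballI)
  fix f g assume fg: "f \<in> carrier P" "g \<in> carrier P"
  note cl = P_closed[OF fg(1)] P_closed[OF fg(2)]
  have "socle_trace (f \<oplus>\<^bsub>P\<^esub> g) =
      (\<Oplus>e\<in>edge_pairs. (case e of (a, b) \<Rightarrow> wt a b \<otimes> f [a, b, a]) \<oplus> (case e of (a, b) \<Rightarrow> wt a b \<otimes> g [a, b, a]))"
    unfolding socle_trace_def using cl wt_closed
    by (intro K.finsum_cong') (auto simp: P_add K.r_distr edge_pairs_def)
  also have "\<dots> = socle_trace f \<oplus> socle_trace g"
    unfolding socle_trace_def using cl wt_closed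
    by (intro K.finsum_addf) (auto simp: edge_pairs_def)
  finally show "socle_trace (f \<oplus>\<^bsub>P\<^esub> g) = socle_trace f \<oplus> socle_trace g" .
next
  fix c f assume cf: "c \<in> carrier K" "f \<in> carrier P"
  note cl = cf(1) P_closed[OF cf(2)]
  have "c \<otimes> socle_trace f = (\<Oplus>e\<in>edge_pairs. c \<otimes> (case e of (a, b) \<Rightarrow> wt a b \<otimes> f [a, b, a]))"
    unfolding socle_trace_def using cl wt_closed
    by (intro K.finsum_rdistr finite_edge_pairs) (auto simp: edge_pairs_def)
  also have "\<dots> = socle_trace (c \<odot>\<^bsub>P\<^esub> f)"
    unfolding socle_trace_def using cl wt_closed
    by (intro K.finsum_cong') (auto simp: P_smult K.m_lcomm edge_pairs_def)
  finally show "socle_trace (c \<odot>\<^bsub>P\<^esub> f) = c \<otimes> socle_trace f" by simp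
qed (rule socle_trace_closed)

lemma socle_trace_single:
  assumes f: "f \<in> carrier P" and ab: "{a, b} \<in> E"
    and "\<And>c d. {c, d} \<in> E \<Longrightarrow> (c, d) \<noteq> (a, b) \<Longrightarrow> f [c, d, c] = \<zero>"
  shows "socle_trace f = wt a b \<otimes> f [a, b, a]"
proof -
  have "socle_trace f = (\<Oplus>e\<in>edge_pairs. if (a, b) = e
      then (case e of (a, b) \<Rightarrow> wt a b \<otimes> f [a, b, a]) else \<zero>)"
    unfolding socle_trace_def
  proof (rule K.finsum_cong')
    fix e assume e: "e \<in> edge_pairs"
    show "(case e of (c, d) \<Rightarrow> wt c d \<otimes> f [c, d, c]) =
        (if (a, b) = e then (case e of (c, d) \<Rightarrow> wt c d \<otimes> f [c, d, c]) else \<zero>)"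
    proof (cases "(a, b) = e")
      case False
      then obtain c d where cd: "e = (c, d)" "{c, d} \<in> E" "(c, d) \<noteq> (a, b)"
        using e by (auto simp: edge_pairs_def)
      then show ?thesis using False assms(3)[OF cd(2,3)] wt_closed by simp
    qed simp
  qed (use P_closed[OF f] wt_closed in \<open>auto simp: edge_pairs_def\<close>)
  also have "\<dots> = wt a b \<otimes> f [a, b, a]"
    using P_closed[OF f] wt_closed ab
    by (subst K.finsum_singleton[OF _ finite_edge_pairs]) (auto simp: edge_pairs_def)
  finally show ?thesis .
qed

lemma socle_trace_zero:
  assumes "\<And>a b. {a, b} \<in> E \<Longrightarrow> f [a, b, a] = \<zero>"
  shows "socle_trace f = \<zero>"
  unfolding socle_trace_def using assms wt_closed
  by (intro K.add.finprod_one_eqI) (auto simp: edge_pairs_def)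

lemma homogeneous_socle_trace: "homogeneous_trace K (homogeneous vwalk_length) socle_trace"
  unfolding homogeneous_trace_def
proof (intro exI[of _ 2] allI impI ballI)
  fix n f assume n: "n \<noteq> 2" and f: "f \<in> homogeneous vwalk_length n"
  show "socle_trace f = \<zero>"
  proof (rule socle_trace_zero)
    fix a b
    show "f [a, b, a] = \<zero>"
      using n f unfolding homogeneous_def by fastforce
  qed
qed

lemma pverts_double_quiver [simp]: "pverts (double_quiver V E) = V"
  by (simp add: double_quiver_def)

lemma zigzag_quiver_eq: "zigzag_quiver V E = double_quiver V E"
  using two_verts by (simp add: zigzag_quiver_def)

lemma zigzag_path_degree_eq: "zigzag_path_degree V = vwalk_length"
  using two_verts by (auto simp: zigzag_path_degree_def)

abbreviation "R \<equiv> skew_zigzag_relations K V E v"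
abbreviation "I \<equiv> skew_zigzag_ideal K V E v"

text \<open>The relations for two and for more vertices have a common form: either a path of length at least
  two, not of the form \<open>[a, b, a]\<close>, or the difference of two closed paths.\<close>

lemma relationE:
  assumes "x \<in> R"
  obtains (path) p where "x = path_elt K p" and "vwalk p (with_proj (double_quiver V E))"
      and "length p \<ge> 3" and "\<And>a b. p \<noteq> [a, b, a]"
  | (diff) a b c where "x = path_elt K [a, b, a] \<ominus>\<^bsub>P\<^esub> v a b c \<odot>\<^bsub>P\<^esub> path_elt K [a, c, a]"
      and "{a, b} \<in> E" and "{a, c} \<in> E"
proof (cases "card V = 2")
  case True
  then obtain p where "x = path_elt K p" "vwalk p (with_proj (double_quiver V E))" "length p > 3"
    using assms by (auto simp: skew_zigzag_relations_def Let_def zigzag_quiver_eq)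
  then show ?thesis by (intro path) auto
next
  case False
  then consider a b c where "x = path_elt K [a, b, c]" "{a, b} \<in> E" "{b, c} \<in> E" "a \<noteq> c"
    | a b c where "x = path_elt K [a, b, a] \<ominus>\<^bsub>P\<^esub> v a b c \<odot>\<^bsub>P\<^esub> path_elt K [a, c, a]"
      "{a, b} \<in> E" "{a, c} \<in> E"
    using assms two_verts by (auto simp: skew_zigzag_relations_def Let_def zigzag_quiver_eq)
  then show ?thesis
  proof cases
    case (1 a b c)
    then show ?thesis using edgeD by (intro path[of "[a, b, c]"]) auto
  next
    case (2 a b c)
    then show ?thesis by (rule diff)
  qed
qed

lemma v_closed: "{a, b} \<in> E \<Longrightarrow> {a, c} \<in> E \<Longrightarrow> v a b c \<in> carrier K"
  using coeffs by (simp add: skew_zigzag_coeffs_def)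

lemma vwalk_loop: "{a, b} \<in> E \<Longrightarrow> vwalk [a, b, a] (with_proj (double_quiver V E))"
  using edgeD by simp

lemma relations_in: "R \<subseteq> carrier P"
proof
  fix x assume "x \<in> R"
  then show "x \<in> carrier P"
  proof (cases rule: relationE)
    case (diff a b c)
    then show ?thesis unfolding diff(1)
      by (intro P.M.minus_closed P_smult_closed path_elt_in vwalk_loop v_closed)
  qed auto
qed

lemma socle_trace_sandwich_loop:
  assumes g: "g \<in> carrier P" and h: "h \<in> carrier P" and ab: "{a, b} \<in> E"
  shows "socle_trace (g \<otimes>\<^bsub>P\<^esub> path_elt K [a, b, a] \<otimes>\<^bsub>P\<^esub> h) = wt a b \<otimes> (g [a] \<otimes> h [a])"
proof -
  have p: "path_elt K [a, b, a] \<in> carrier P" using vwalk_loop[OF ab] by blast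
  have val: "(g \<otimes>\<^bsub>P\<^esub> path_elt K [a, b, a] \<otimes>\<^bsub>P\<^esub> h) [c, d, c] =
      g [c] \<otimes> path_elt K [a, b, a] [c, d, c] \<otimes> h [c]" for c d
    by (rule P_sandwich_3[OF g p h]) (rule path_elt_other, auto)
  have "socle_trace (g \<otimes>\<^bsub>P\<^esub> path_elt K [a, b, a] \<otimes>\<^bsub>P\<^esub> h) =
      wt a b \<otimes> (g \<otimes>\<^bsub>P\<^esub> path_elt K [a, b, a] \<otimes>\<^bsub>P\<^esub> h) [a, b, a]"
    using P_closed[OF g] P_closed[OF h]
    by (intro socle_trace_single ab P_mult_closed g h p) (auto simp: val path_elt_self path_elt_other)
  then show ?thesis using P_closed[OF g] unfolding val by (simp add: path_elt_self path_elt_other)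
qed

text \<open>A path that is not of the form \<open>[a, b, a]\<close> contributes nothing to the trace. The two closed paths
  in a difference contribute \<open>wt a b\<close> and \<open>v a b c \<otimes> wt a c\<close>, with the same factor from \<open>g\<close>
  and \<open>h\<close>, so they cancel by \<open>wt_change\<close>.\<close>

lemma socle_trace_relations:
  assumes x: "x \<in> R" and g: "g \<in> carrier P" and h: "h \<in> carrier P"
  shows "socle_trace (g \<otimes>\<^bsub>P\<^esub> x \<otimes>\<^bsub>P\<^esub> h) = \<zero>"
  using x
proof (cases rule: relationE)
  case (path p)
  have xP: "x \<in> carrier P" using relations_in x by blast
  show ?thesis
  proof (rule socle_trace_zero)
    fix a b
    have "(g \<otimes>\<^bsub>P\<^esub> x \<otimes>\<^bsub>P\<^esub> h) [a, b, a] = g [a] \<otimes> x [a, b, a] \<otimes> h [a]"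
      using path(3) unfolding path(1)
      by (intro P_sandwich_3 g h xP[unfolded path(1)] path_elt_other) auto
    also have "\<dots> = \<zero>"
      using path(4)[of a b] P_closed[OF g] P_closed[OF h] by (simp add: path(1) path_elt_self path_elt_other)
    finally show "(g \<otimes>\<^bsub>P\<^esub> x \<otimes>\<^bsub>P\<^esub> h) [a, b, a] = \<zero>" .
  qed
next
  case (diff a b c)
  define t where "t x = socle_trace (g \<otimes>\<^bsub>P\<^esub> x \<otimes>\<^bsub>P\<^esub> h)" for x
  have t: "trace_map K P t"
    unfolding t_def
    using P.trace_map_mult_left[OF P.trace_map_mult[OF trace_map_socle_trace h] g] .
  have p: "path_elt K [a, b, a] \<in> carrier P" "path_elt K [a, c, a] \<in> carrier P"
    using vwalk_loop diff by blast+
  have vc: "v a b c \<in> carrier K" using v_closed diff by blast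
  have cl: "wt a c \<in> carrier K" "g [a] \<otimes> h [a] \<in> carrier K"
    using wt_closed diff(3) P_closed[OF g] P_closed[OF h] by auto
  have "t x = t (path_elt K [a, b, a]) \<ominus> v a b c \<otimes> t (path_elt K [a, c, a])"
    unfolding diff(1) using t p vc
    by (simp only: P.trace_map_minus[OF t p(1) P_smult_closed[OF vc p(2)]]) (simp add: trace_map_def)
  also have "\<dots> = v a b c \<otimes> wt a c \<otimes> (g [a] \<otimes> h [a]) \<ominus> v a b c \<otimes> (wt a c \<otimes> (g [a] \<otimes> h [a]))"
    unfolding t_def socle_trace_sandwich_loop[OF g h diff(2)] socle_trace_sandwich_loop[OF g h diff(3)]
      wt_change[OF diff(2,3)] ..
  also have "\<dots> = \<zero>" using cl vc by (simp add: K.m_assoc a_minus_def K.r_neg)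
  finally show ?thesis by (simp add: t_def)
qed

lemma I_eq: "I = Idl\<^bsub>P\<^esub> R"
  by (simp add: skew_zigzag_ideal_def zigzag_quiver_eq)

lemma ideal_I: "ideal I P"
  unfolding I_eq by (rule P.A.genideal_ideal[OF relations_in])

lemma R_in_I: "x \<in> R \<Longrightarrow> x \<in> I"
  unfolding I_eq using P.A.genideal_self[OF relations_in] by blast

lemma socle_trace_ideal: "x \<in> I \<Longrightarrow> socle_trace x = \<zero>"
  unfolding I_eq
  by (rule P.trace_vanishes_on_genideal[OF trace_map_socle_trace relations_in socle_trace_relations])

sublocale AI: algebra_ideal K P I
  by (intro algebra_ideal.intro P.unital_algebra_axioms ideal_I)

definition basis :: "'b list set" where
  "basis = (\<lambda>a. [a]) ` V \<union> (\<lambda>(a, b). [a, b]) ` edge_pairs \<union> (\<lambda>a. [a, nbr a, a]) ` V"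

lemma finite_basis: "finite basis"
  by (simp add: basis_def finite_V finite_edge_pairs)

lemma basis_vwalk: "p \<in> basis \<Longrightarrow> vwalk p (with_proj (double_quiver V E))"
  using nbr edgeD vwalk_loop by (auto simp: basis_def edge_pairs_def)

text \<open>With two vertices there is no such path, so it is always among the relations for at least three
  vertices.\<close>

lemma turn_in_ideal:
  assumes ab: "{a, b} \<in> E" and bc: "{b, c} \<in> E" and ac: "a \<noteq> c"
  shows "path_elt K [a, b, c] \<in> I"
proof -
  have "card {a, b, c} = 3" using ac edgeD(3)[OF ab] edgeD(3)[OF bc] by auto
  moreover have "card {a, b, c} \<le> card V"
    using edgeD ab bc finite_V by (intro card_mono) auto
  ultimately have "card V \<noteq> 1" "card V \<noteq> 2" by auto
  then have "path_elt K [a, b, c] \<in> R"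
    using ab bc ac by (auto simp: skew_zigzag_relations_def Let_def)
  then show ?thesis by (rule R_in_I)
qed

lemma loop_diff_in_ideal:
  assumes "card V \<noteq> 2" and ab: "{a, b} \<in> E" and ac: "{a, c} \<in> E"
  shows "path_elt K [a, b, a] \<ominus>\<^bsub>P\<^esub> v a b c \<odot>\<^bsub>P\<^esub> path_elt K [a, c, a] \<in> I"
proof -
  have "card V \<noteq> 1" using two_verts by simp
  then have "path_elt K [a, b, a] \<ominus>\<^bsub>P\<^esub> v a b c \<odot>\<^bsub>P\<^esub> path_elt K [a, c, a] \<in> R"
    using assms by (auto simp: skew_zigzag_relations_def Let_def zigzag_quiver_eq)
  then show ?thesis by (rule R_in_I)
qed

text \<open>With two vertices the path is itself a relation. Otherwise, it contains a turn, that is, two successive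
  arrows that are not inverse to each other, or it is \<open>[x, y, x, y]\<close>. In the latter case there is a third
  vertex \<open>c\<close> adjacent to \<open>x\<close> or to \<open>y\<close>. If it is adjacent to \<open>x\<close>, then \<open>[x, y, x]\<close>
  may be replaced by \<open>[x, c, x]\<close>, which gives
  \<open>[x, c, x, y]\<close>, and this path turns at \<open>x\<close>. The other case is the mirror image.\<close>

lemma path_3_in_ideal:
  assumes xy: "{x, y} \<in> E" and yz: "{y, z} \<in> E" and zu: "{z, u} \<in> E"
  shows "path_elt K [x, y, z, u] \<in> I"
proof -
  have e: "path_elt K [a, b] \<in> carrier P" if "{a, b} \<in> E" for a b
    using edgeD[OF that] that by (intro path_elt_in) simp
  have split_r: "path_elt K [x, y, z, u] = path_elt K [x, y, z] \<otimes>\<^bsub>P\<^esub> path_elt K [z, u]"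
    by (simp add: path_elt_mult_P)
  have split_l: "path_elt K [x, y, z, u] = path_elt K [x, y] \<otimes>\<^bsub>P\<^esub> path_elt K [y, z, u]"
    by (simp add: path_elt_mult_P)
  consider "card V = 2" | "x \<noteq> z" | "y \<noteq> u" | "card V \<noteq> 2" "x = z" "y = u" by blast
  then show ?thesis
  proof cases
    case 1
    have "path_elt K [x, y, z, u] \<in> R"
      using 1 assms edgeD by (auto simp: skew_zigzag_relations_def Let_def zigzag_quiver_eq)
    then show ?thesis by (rule R_in_I)
  next
    case 2
    show ?thesis unfolding split_r
      by (rule AI.I.I_r_closed[OF turn_in_ideal[OF xy yz 2] e[OF zu]])
  next
    case 3
    show ?thesis unfolding split_l
      by (rule AI.I.I_l_closed[OF turn_in_ideal[OF yz zu 3] e[OF xy]])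
  next
    case 4
    have "{x, y} \<noteq> V" using 4(1) edgeD(3)[OF xy] by (metis card_2_iff)
    then obtain a c where ac: "a \<in> {x, y}" "c \<in> V - {x, y}" "{a, c} \<in> E"
      using exit_edge[of "{x, y}"] edgeD xy by blast
    consider "{x, c} \<in> E" | "{y, c} \<in> E" using ac by blast
    then show ?thesis
    proof cases
      case 1
      have "path_elt K [x, c, x] \<otimes>\<^bsub>P\<^esub> path_elt K [x, y] =
          path_elt K [x, c] \<otimes>\<^bsub>P\<^esub> path_elt K [c, x, y]"
        by (simp add: path_elt_mult_P)
      also have "\<dots> \<in> I"
        using ac edgeD(4)[OF 1] xy by (intro AI.I.I_l_closed turn_in_ideal e 1) auto
      finally have "path_elt K [x, y, x] \<otimes>\<^bsub>P\<^esub> path_elt K [x, y] \<in> I"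
        using AI.mult_in_ideal_right[OF _ _ _ v_closed[OF xy 1] loop_diff_in_ideal[OF 4(1) xy 1]]
          path_elt_in[OF vwalk_loop[OF xy]] path_elt_in[OF vwalk_loop[OF 1]] e[OF xy] by blast
      then show ?thesis unfolding split_r using 4 by simp
    next
      case 2
      note yx = edgeD(4)[OF xy]
      have "path_elt K [x, y] \<otimes>\<^bsub>P\<^esub> path_elt K [y, c, y] =
          path_elt K [x, y, c] \<otimes>\<^bsub>P\<^esub> path_elt K [c, y]"
        by (simp add: path_elt_mult_P)
      also have "\<dots> \<in> I"
        using ac edgeD(4)[OF 2] xy 2 by (intro AI.I.I_r_closed turn_in_ideal e) auto
      finally have "path_elt K [x, y] \<otimes>\<^bsub>P\<^esub> path_elt K [y, x, y] \<in> I"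
        using AI.mult_in_ideal_left[OF _ _ _ v_closed[OF yx 2] loop_diff_in_ideal[OF 4(1) yx 2]]
          path_elt_in[OF vwalk_loop[OF yx]] path_elt_in[OF vwalk_loop[OF 2]] e[OF xy] by blast
      then show ?thesis unfolding split_l using 4 by simp
    qed
  qed
qed

lemma long_path_in_ideal:
  assumes "vwalk p (with_proj (double_quiver V E))" and "length p \<ge> 4"
  shows "path_elt K p \<in> I"
proof -
  obtain x y z u q where p: "p = x # y # z # u # q"
    using assms(2) by (auto simp: numeral_eq_Suc Suc_le_length_iff)
  have "path_elt K p = path_elt K [x, y, z, u] \<otimes>\<^bsub>P\<^esub> path_elt K (u # q)"
    by (simp add: p path_elt_mult_P)
  also have "\<dots> \<in> I"
    using assms(1) unfolding p by (intro AI.I.I_r_closed path_3_in_ideal path_elt_in) auto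
  finally show ?thesis .
qed

lemma path_reduces_to_basis:
  assumes p: "vwalk p (with_proj (double_quiver V E))"
  shows "path_elt K p \<in> I \<or>
      (\<exists>b\<in>basis. \<exists>c\<in>carrier K. path_elt K p \<ominus>\<^bsub>P\<^esub> c \<odot>\<^bsub>P\<^esub> path_elt K b \<in> I)"
proof -
  have in_basis: ?thesis if "p \<in> basis"
  proof -
    have "path_elt K p \<ominus>\<^bsub>P\<^esub> \<one> \<odot>\<^bsub>P\<^esub> path_elt K p = \<zero>\<^bsub>P\<^esub>"
      using path_elt_in[OF p] by (simp add: a_minus_def P.M.r_neg)
    then show ?thesis using that AI.I.zero_closed by (metis K.one_closed)
  qed
  consider a where "p = [a]" | a b where "p = [a, b]" | a b c where "p = [a, b, c]" | "length p \<ge> 4"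
  proof (cases p)
    case (Cons a q)
    note p1 = this
    then show thesis
    proof (cases q)
      case (Cons b r)
      note p2 = this
      then show thesis
      proof (cases r)
        case (Cons c s)
        then show thesis using p1 p2 that(3,4) by (cases s) auto
      qed (use p1 that in simp)
    qed (use that in simp)
  qed (use p in simp)
  then show ?thesis
  proof cases
    case (1 a)
    then show ?thesis using p by (intro in_basis) (auto simp: basis_def)
  next
    case (2 a b)
    then show ?thesis using p by (intro in_basis) (auto simp: basis_def edge_pairs_def)
  next
    case (3 a b c)
    then have ab: "{a, b} \<in> E" and bc: "{b, c} \<in> E" using p by auto
    show ?thesis
    proof (cases "a = c")
      case False
      then show ?thesis using turn_in_ideal[OF ab bc] 3 by simp
    next
      case True
      have a: "a \<in> V" using edgeD(1)[OF ab] .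
      note n = nbr[OF a]
      show ?thesis
      proof (cases "card V = 2")
        case True
        have "b = nbr a"
        proof (rule ccontr)
          assume "b \<noteq> nbr a"
          then have "card {a, b, nbr a} = 3" using edgeD(3)[OF ab] edgeD(3)[OF n] by auto
          moreover have "card {a, b, nbr a} \<le> card V"
            using a edgeD(2)[OF ab] edgeD(2)[OF n] finite_V by (intro card_mono) auto
          ultimately show False using True by simp
        qed
        then show ?thesis using 3 \<open>a = c\<close> a by (intro in_basis) (auto simp: basis_def)
      next
        case False
        then have "path_elt K p \<ominus>\<^bsub>P\<^esub> v a b (nbr a) \<odot>\<^bsub>P\<^esub> path_elt K [a, nbr a, a] \<in> I"
          using loop_diff_in_ideal[OF _ ab n] 3 \<open>a = c\<close> by simp
        moreover have "[a, nbr a, a] \<in> basis" using a by (auto simp: basis_def)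
        ultimately show ?thesis using v_closed[OF ab n] by blast
      qed
    qed
  next
    case 4
    then show ?thesis using long_path_in_ideal[OF p] by simp
  qed
qed

lemma basisE:
  assumes "p \<in> basis"
  obtains (vertex) a where "p = [a]" and "a \<in> V"
  | (arc) a b where "p = [a, b]" and "{a, b} \<in> E"
  | (loop) a where "p = [a, nbr a, a]" and "a \<in> V"
  using assms by (auto simp: basis_def edge_pairs_def)

text \<open>Every path in the basis has a partner that singles out its coefficient: the product of \<open>g\<close> with
  the partner has at most one nonzero coefficient on the closed paths of length two. The partner of
  \<open>[a]\<close> is \<open>[a, nbr a, a]\<close> and conversely \<open>[a]\<close> serves for \<open>[a, nbr a, a]\<close>, as \<open>g\<close> has no other
  closed path at \<open>a\<close>; the partner of \<open>[a, b]\<close> is \<open>[b, a]\<close>.\<close>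

lemma nondegenerate_left:
  assumes g: "g \<in> carrier P" and supp: "\<And>q. q \<notin> basis \<Longrightarrow> g q = \<zero>"
    and zero: "\<And>y. y \<in> carrier P \<Longrightarrow> socle_trace (g \<otimes>\<^bsub>P\<^esub> y) = \<zero>" and p: "p \<in> basis"
  shows "g p = \<zero>"
proof -
  note gc = P_closed[OF g]
  have single: "(g \<otimes>\<^bsub>P\<^esub> y) [a, b, a] = \<zero>"
    if y: "y \<in> carrier P" and ab: "{a, b} \<in> E"
      and "\<And>c d. \<lbrakk>{c, d} \<in> E; (c, d) \<noteq> (a, b)\<rbrakk> \<Longrightarrow> (g \<otimes>\<^bsub>P\<^esub> y) [c, d, c] = \<zero>" for a b y
  proof -
    have gy: "g \<otimes>\<^bsub>P\<^esub> y \<in> carrier P" using g y by (rule P_mult_closed)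
    have "wt a b \<otimes> (g \<otimes>\<^bsub>P\<^esub> y) [a, b, a] = \<zero>"
      using socle_trace_single[OF gy ab that(3)] zero[OF y] by simp
    then show ?thesis
      using K.integral_iff[OF wt_closed[OF ab] P_closed[OF gy]] wt_nonzero[OF ab] by simp
  qed
  show ?thesis
    using p
  proof (cases rule: basisE)
    case (vertex a)
    have y: "path_elt K [a, nbr a, a] \<in> carrier P"
      using vwalk_loop nbr[OF vertex(2)] by blast
    have "(g \<otimes>\<^bsub>P\<^esub> path_elt K [a, nbr a, a]) [a, nbr a, a] = \<zero>"
      by (rule single[OF y nbr[OF vertex(2)]]) (use gc in \<open>auto simp: P_mult_3 g y path_elt_self path_elt_other\<close>)
    then show ?thesis using gc by (simp add: vertex P_mult_3 g y) (simp add: path_elt_self path_elt_other)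
  next
    case (arc a b)
    have y: "path_elt K [b, a] \<in> carrier P" using arc edgeD by auto
    have "(g \<otimes>\<^bsub>P\<^esub> path_elt K [b, a]) [a, b, a] = \<zero>"
      by (rule single[OF y arc(2)]) (use gc in \<open>auto simp: P_mult_3 g y path_elt_self path_elt_other\<close>)
    then show ?thesis using gc by (simp add: arc P_mult_3 g y) (simp add: path_elt_self path_elt_other)
  next
    case (loop a)
    have y: "path_elt K [a] \<in> carrier P" using loop by auto
    have "(g \<otimes>\<^bsub>P\<^esub> path_elt K [a]) [a, nbr a, a] = \<zero>"
    proof (rule single[OF y nbr[OF loop(2)]])
      fix c d assume "(c, d) \<noteq> (a, nbr a)"
      then have "c = a \<Longrightarrow> g [c, d, c] = \<zero>" by (intro supp) (auto simp: basis_def)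
      then show "(g \<otimes>\<^bsub>P\<^esub> path_elt K [a]) [c, d, c] = \<zero>"
        using gc by (cases "c = a") (auto simp: P_mult_3 g y path_elt_self path_elt_other)
    qed
    then show ?thesis using gc by (simp add: loop P_mult_3 g y) (simp add: path_elt_self path_elt_other)
  qed
qed

lemma nondegenerate_right:
  assumes g: "g \<in> carrier P" and supp: "\<And>q. q \<notin> basis \<Longrightarrow> g q = \<zero>"
    and zero: "\<And>y. y \<in> carrier P \<Longrightarrow> socle_trace (y \<otimes>\<^bsub>P\<^esub> g) = \<zero>" and p: "p \<in> basis"
  shows "g p = \<zero>"
proof -
  note gc = P_closed[OF g]
  have single: "(y \<otimes>\<^bsub>P\<^esub> g) [a, b, a] = \<zero>"
    if y: "y \<in> carrier P" and ab: "{a, b} \<in> E"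
      and "\<And>c d. \<lbrakk>{c, d} \<in> E; (c, d) \<noteq> (a, b)\<rbrakk> \<Longrightarrow> (y \<otimes>\<^bsub>P\<^esub> g) [c, d, c] = \<zero>" for a b y
  proof -
    have gy: "y \<otimes>\<^bsub>P\<^esub> g \<in> carrier P" using y g by (rule P_mult_closed)
    have "wt a b \<otimes> (y \<otimes>\<^bsub>P\<^esub> g) [a, b, a] = \<zero>"
      using socle_trace_single[OF gy ab that(3)] zero[OF y] by simp
    then show ?thesis
      using K.integral_iff[OF wt_closed[OF ab] P_closed[OF gy]] wt_nonzero[OF ab] by simp
  qed
  show ?thesis
    using p
  proof (cases rule: basisE)
    case (vertex a)
    have y: "path_elt K [a, nbr a, a] \<in> carrier P"
      using vwalk_loop nbr[OF vertex(2)] by blast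
    have "(path_elt K [a, nbr a, a] \<otimes>\<^bsub>P\<^esub> g) [a, nbr a, a] = \<zero>"
      by (rule single[OF y nbr[OF vertex(2)]]) (use gc in \<open>auto simp: P_mult_3 g y path_elt_self path_elt_other\<close>)
    then show ?thesis using gc by (simp add: vertex P_mult_3 g y) (simp add: path_elt_self path_elt_other)
  next
    case (arc a b)
    have y: "path_elt K [b, a] \<in> carrier P" using arc edgeD by auto
    have "(path_elt K [b, a] \<otimes>\<^bsub>P\<^esub> g) [b, a, b] = \<zero>"
      by (rule single[OF y edgeD(4)[OF arc(2)]]) (use gc in \<open>auto simp: P_mult_3 g y path_elt_self path_elt_other\<close>)
    then show ?thesis using gc by (simp add: arc P_mult_3 g y) (simp add: path_elt_self path_elt_other)
  next
    case (loop a)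
    have y: "path_elt K [a] \<in> carrier P" using loop by auto
    have "(path_elt K [a] \<otimes>\<^bsub>P\<^esub> g) [a, nbr a, a] = \<zero>"
    proof (rule single[OF y nbr[OF loop(2)]])
      fix c d assume "(c, d) \<noteq> (a, nbr a)"
      then have "c = a \<Longrightarrow> g [c, d, c] = \<zero>" by (intro supp) (auto simp: basis_def)
      then show "(path_elt K [a] \<otimes>\<^bsub>P\<^esub> g) [c, d, c] = \<zero>"
        using gc by (cases "c = a") (auto simp: P_mult_3 g y path_elt_self path_elt_other)
    qed
    then show ?thesis using gc by (simp add: loop P_mult_3 g y) (simp add: path_elt_self path_elt_other)
  qed
qed

text \<open>Reversing the arrows \<open>(a, b) \<mapsto> (b, a)\<close> matches the terms \<open>f [a, b] \<otimes> g [b, a]\<close> of the two sides;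
  the other two kinds of terms are interchanged.\<close>

lemma symmetric_socle_trace:
  assumes one: "\<And>a b c. v a b c = \<one>"
  shows "symmetric_trace P socle_trace"
  unfolding symmetric_trace_def
proof (intro ballI)
  fix f g assume f: "f \<in> carrier P" and g: "g \<in> carrier P"
  note fc = P_closed[OF f] and gc = P_closed[OF g]
  have expand: "socle_trace (f \<otimes>\<^bsub>P\<^esub> g) =
      (\<Oplus>e\<in>edge_pairs. case e of (a, b) \<Rightarrow> f [a] \<otimes> g [a, b, a]) \<oplus>
      (\<Oplus>e\<in>edge_pairs. case e of (a, b) \<Rightarrow> f [a, b] \<otimes> g [b, a]) \<oplus>
      (\<Oplus>e\<in>edge_pairs. case e of (a, b) \<Rightarrow> f [a, b, a] \<otimes> g [a])" (is "_ = ?R")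
    if f: "f \<in> carrier P" and g: "g \<in> carrier P" for f g
  proof -
    note fc = P_closed[OF f] and gc = P_closed[OF g]
    have "?R = (\<Oplus>e\<in>edge_pairs. (case e of (a, b) \<Rightarrow> f [a] \<otimes> g [a, b, a]) \<oplus>
      (case e of (a, b) \<Rightarrow> f [a, b] \<otimes> g [b, a]) \<oplus> (case e of (a, b) \<Rightarrow> f [a, b, a] \<otimes> g [a]))"
      using fc gc by (simp add: split_def K.finsum_addf Pi_def)
    also have "\<dots> = socle_trace (f \<otimes>\<^bsub>P\<^esub> g)"
      unfolding socle_trace_def using fc gc
      by (intro K.finsum_cong') (auto simp: wt_def one P_mult_3 f g)
    finally show ?thesis by simp
  qed
  have swap: "(\<Oplus>e\<in>edge_pairs. case e of (a, b) \<Rightarrow> f [a, b] \<otimes> g [b, a]) =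
      (\<Oplus>e\<in>edge_pairs. case e of (a, b) \<Rightarrow> g [a, b] \<otimes> f [b, a])"
  proof -
    have im: "prod.swap ` edge_pairs = edge_pairs"
      by (auto simp: edge_pairs_def insert_commute image_iff)
    have "(\<Oplus>e\<in>prod.swap ` edge_pairs. case e of (a, b) \<Rightarrow> f [a, b] \<otimes> g [b, a]) =
        (\<Oplus>e\<in>edge_pairs. case prod.swap e of (a, b) \<Rightarrow> f [a, b] \<otimes> g [b, a])"
      using fc gc by (intro K.finsum_reindex) auto
    also have "\<dots> = (\<Oplus>e\<in>edge_pairs. case e of (a, b) \<Rightarrow> g [a, b] \<otimes> f [b, a])"
      using fc gc by (intro K.finsum_cong') (auto simp: K.m_comm)
    finally show ?thesis unfolding im .
  qed
  have outer: "(\<Oplus>e\<in>edge_pairs. case e of (a, b) \<Rightarrow> f [a] \<otimes> g [a, b, a]) =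
      (\<Oplus>e\<in>edge_pairs. case e of (a, b) \<Rightarrow> g [a, b, a] \<otimes> f [a])"
    "(\<Oplus>e\<in>edge_pairs. case e of (a, b) \<Rightarrow> f [a, b, a] \<otimes> g [a]) =
      (\<Oplus>e\<in>edge_pairs. case e of (a, b) \<Rightarrow> g [a] \<otimes> f [a, b, a])"
    using fc gc by (intro K.finsum_cong'; auto simp: K.m_comm)+
  have cl: "(\<Oplus>e\<in>edge_pairs. case e of (a, b) \<Rightarrow> g [a, b, a] \<otimes> f [a]) \<in> carrier K"
    "(\<Oplus>e\<in>edge_pairs. case e of (a, b) \<Rightarrow> g [a, b] \<otimes> f [b, a]) \<in> carrier K"
    "(\<Oplus>e\<in>edge_pairs. case e of (a, b) \<Rightarrow> g [a] \<otimes> f [a, b, a]) \<in> carrier K"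
    using fc gc by (auto intro!: K.finsum_closed)
  show "socle_trace (f \<otimes>\<^bsub>P\<^esub> g) = socle_trace (g \<otimes>\<^bsub>P\<^esub> f)"
    unfolding expand[OF f g] expand[OF g f] swap outer using cl by (simp add: K.a_ac)
qed

theorem skew_zigzag_frobenius:
  "graded_frobenius_algebra K (skew_zigzag_algebra K V E v) (skew_zigzag_component K V E v)"
  and skew_zigzag_symmetric: "(\<And>a b c. v a b c = \<one>) \<Longrightarrow>
    graded_symmetric_algebra K (skew_zigzag_algebra K V E v) (skew_zigzag_component K V E v)"
proof -
  have alg: "skew_zigzag_algebra K V E v = quot_algebra P I"
    by (simp add: skew_zigzag_algebra_def zigzag_quiver_eq)
  have comp: "skew_zigzag_component K V E v = (\<lambda>n. (+>\<^bsub>P\<^esub>) I ` homogeneous vwalk_length n)"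
    by (simp add: skew_zigzag_component_def zigzag_quiver_eq zigzag_path_degree_eq homogeneous_def Let_def fun_eq_iff)
  have deg: "vwalk_length (take (Suc i) r) + vwalk_length (drop i r) = vwalk_length r"
    if "i < length r" for i and r :: "'b list"
    using that by simp
  show "graded_frobenius_algebra K (skew_zigzag_algebra K V E v) (skew_zigzag_component K V E v)"
    unfolding alg comp
  proof (rule path_quotient_frobenius(1)[where deg = vwalk_length, OF ideal_I deg finite_basis
        basis_vwalk path_reduces_to_basis trace_map_socle_trace socle_trace_ideal homogeneous_socle_trace])
    fix g p assume a: "g \<in> carrier P" "\<And>q. q \<notin> basis \<Longrightarrow> g q = \<zero>" "p \<in> basis"
    show "g p = \<zero>" if "\<And>y. y \<in> carrier P \<Longrightarrow> socle_trace (g \<otimes>\<^bsub>P\<^esub> y) = \<zero>"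
      by (rule nondegenerate_left[OF a(1,2) that a(3)])
    show "g p = \<zero>" if "\<And>y. y \<in> carrier P \<Longrightarrow> socle_trace (y \<otimes>\<^bsub>P\<^esub> g) = \<zero>"
      by (rule nondegenerate_right[OF a(1,2) that a(3)])
  qed
  assume "\<And>a b c. v a b c = \<one>"
  then have sym: "symmetric_trace P socle_trace" by (rule symmetric_socle_trace)
  show "graded_symmetric_algebra K (skew_zigzag_algebra K V E v) (skew_zigzag_component K V E v)"
    unfolding alg comp
  proof (rule path_quotient_frobenius(2)[where deg = vwalk_length, OF ideal_I deg finite_basis
        basis_vwalk path_reduces_to_basis trace_map_socle_trace socle_trace_ideal homogeneous_socle_trace
        _ _ sym])
    fix g p assume a: "g \<in> carrier P" "\<And>q. q \<notin> basis \<Longrightarrow> g q = \<zero>" "p \<in> basis"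
    show "g p = \<zero>" if "\<And>y. y \<in> carrier P \<Longrightarrow> socle_trace (g \<otimes>\<^bsub>P\<^esub> y) = \<zero>"
      by (rule nondegenerate_left[OF a(1,2) that a(3)])
    show "g p = \<zero>" if "\<And>y. y \<in> carrier P \<Longrightarrow> socle_trace (y \<otimes>\<^bsub>P\<^esub> g) = \<zero>"
      by (rule nondegenerate_right[OF a(1,2) that a(3)])
  qed
qed

end

section \<open>The graph with one vertex\<close>

text \<open>The algebra of dual numbers. With \<open>1 = [a]\<close> and \<open>X = [a, a]\<close>, the trace reads off the coefficient of
  \<open>X\<close>, so \<open>1\<close> and \<open>X\<close> are partners of each other.\<close>

lemma one_vertex_frobenius_symmetric:
  fixes K :: "('k, 'm) ring_scheme" and a :: 'a
  assumes "field K"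
  shows "graded_frobenius_algebra K (skew_zigzag_algebra K {a} E v) (skew_zigzag_component K {a} E v)"
    and "graded_symmetric_algebra K (skew_zigzag_algebra K {a} E v) (skew_zigzag_component K {a} E v)"
proof -
  interpret K: field K by fact
  define Q where "Q = \<lparr>pverts = {a}, parcs = {a} \<times> {a}\<rparr>"
  interpret quiver_over_field K Q
    by unfold_locales (simp add: Q_def)
  have zq: "zigzag_quiver {a} E = Q" by (simp add: zigzag_quiver_def Q_def)
  define I where "I = Idl\<^bsub>P\<^esub> {path_elt K [a, a, a]}"
  define B where "B = {[a], [a, a]}"
  define t where "t f = f [a, a]" for f :: "'a list \<Rightarrow> 'k"
  let ?deg = "\<lambda>p. 2 * vwalk_length p"
  have walk: "vwalk p (with_proj Q)" if "p \<noteq> []" "set p \<subseteq> {a}" for p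
    using that by (induction p rule: vwalk_arcs.induct) (auto simp: vwalk_def Q_def)
  have walkD: "p = replicate (length p) a" "p \<noteq> []" if "vwalk p (with_proj Q)" for p
  proof -
    have "\<forall>x\<in>set p. x = a" using that by (auto simp: vwalk_def Q_def)
    then show "p = replicate (length p) a" using replicate_length_same by metis
  qed (use that in \<open>auto simp: vwalk_def\<close>)
  have x: "{path_elt K [a, a, a]} \<subseteq> carrier P" using walk by auto
  have ideal: "ideal I P" unfolding I_def by (rule P.A.genideal_ideal[OF x])
  interpret I: ideal I P by (rule ideal)
  have X2: "path_elt K [a, a, a] \<in> I" unfolding I_def using P.A.genideal_self[OF x] by simp
  have alg: "skew_zigzag_algebra K {a} E v = quot_algebra P I"
    by (simp add: skew_zigzag_algebra_def zq skew_zigzag_ideal_def skew_zigzag_relations_def I_def)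
  have rel: "skew_zigzag_ideal K {a} E v = I"
    by (simp add: skew_zigzag_ideal_def zq skew_zigzag_relations_def I_def)
  have comp: "skew_zigzag_component K {a} E v = (\<lambda>n. (+>\<^bsub>P\<^esub>) I ` homogeneous ?deg n)"
    by (rule ext) (simp add: skew_zigzag_component_def zq rel zigzag_path_degree_def homogeneous_def
        Let_def)
  have deg: "?deg (take (Suc i) r) + ?deg (drop i r) = ?deg r" if "i < length r" for i and r :: "'a list"
    using that by simp
  have walks: "vwalk p (with_proj Q)" if "p \<in> B" for p
    using that by (intro walk) (auto simp: B_def)
  have y: "path_elt K [a] \<in> carrier P" "path_elt K [a, a] \<in> carrier P"
    by (intro path_elt_in walk; simp)+
  have span: "path_elt K p \<in> I \<or>
      (\<exists>b\<in>B. \<exists>c\<in>carrier K. path_elt K p \<ominus>\<^bsub>P\<^esub> c \<odot>\<^bsub>P\<^esub> path_elt K b \<in> I)"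
    if p: "vwalk p (with_proj Q)" for p
  proof (cases "p \<in> B")
    case True
    have "path_elt K p \<ominus>\<^bsub>P\<^esub> \<one>\<^bsub>K\<^esub> \<odot>\<^bsub>P\<^esub> path_elt K p = \<zero>\<^bsub>P\<^esub>"
      using path_elt_in[OF p] by (simp add: a_minus_def P.M.r_neg)
    then show ?thesis using True I.zero_closed by (metis K.one_closed)
  next
    case False
    have "length p \<noteq> 0" "length p \<noteq> 1" "length p \<noteq> 2"
      using walkD[OF p] False by (auto simp: B_def numeral_2_eq_2)
    then obtain n where "length p = Suc (Suc (Suc n))"
      by (metis One_nat_def Suc_1 not0_implies_Suc)
    then have "p = a # a # a # replicate n a" using walkD(1)[OF p] by simp
    then have "path_elt K p = path_elt K [a, a, a] \<otimes>\<^bsub>P\<^esub> path_elt K (a # replicate n a)"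
      by (simp add: path_elt_mult_P)
    also have "\<dots> \<in> I"
      by (rule I.I_r_closed[OF X2]) (auto intro!: path_elt_in walk)
    finally show ?thesis by simp
  qed
  have tr: "trace_map K P t"
    by (auto simp: trace_map_def t_def P_closed P_eval)
  have van: "t f = \<zero>\<^bsub>K\<^esub>" if "f \<in> I" for f
  proof (rule P.trace_vanishes_on_genideal[OF tr x _ that[unfolded I_def]])
    fix z g h assume z: "z \<in> {path_elt K [a, a, a]}" and gh: "g \<in> carrier P" "h \<in> carrier P"
    have zP: "path_elt K [a, a, a] \<in> carrier P" using x by simp
    show "t (g \<otimes>\<^bsub>P\<^esub> z \<otimes>\<^bsub>P\<^esub> h) = \<zero>\<^bsub>K\<^esub>"
      using z P_closed[OF gh(1)] P_closed[OF gh(2)]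
      by (simp add: t_def P_mult_1 P_mult_2 P_mult_closed gh zP path_elt_other)
  qed
  have hom: "homogeneous_trace K (homogeneous ?deg) t"
    unfolding homogeneous_trace_def
  proof (intro exI[of _ 2] allI impI ballI)
    fix n f assume "n \<noteq> 2" "f \<in> homogeneous ?deg n"
    then show "t f = \<zero>\<^bsub>K\<^esub>" unfolding homogeneous_def t_def by fastforce
  qed
  have left: "g p = \<zero>\<^bsub>K\<^esub>" if g: "g \<in> carrier P"
    and zero: "\<And>y. y \<in> carrier P \<Longrightarrow> t (g \<otimes>\<^bsub>P\<^esub> y) = \<zero>\<^bsub>K\<^esub>" and p: "p \<in> B" for g p
    using p zero[OF y(1)] zero[OF y(2)] P_closed[OF g]
    by (auto simp: B_def t_def P_mult_2 g y path_elt_self path_elt_other)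
  have right: "g p = \<zero>\<^bsub>K\<^esub>" if g: "g \<in> carrier P"
    and zero: "\<And>y. y \<in> carrier P \<Longrightarrow> t (y \<otimes>\<^bsub>P\<^esub> g) = \<zero>\<^bsub>K\<^esub>" and p: "p \<in> B" for g p
    using p zero[OF y(1)] zero[OF y(2)] P_closed[OF g]
    by (auto simp: B_def t_def P_mult_2 g y path_elt_self path_elt_other)
  have sym: "symmetric_trace P t"
    unfolding symmetric_trace_def
  proof (intro ballI)
    fix f g assume f: "f \<in> carrier P" and g: "g \<in> carrier P"
    show "t (f \<otimes>\<^bsub>P\<^esub> g) = t (g \<otimes>\<^bsub>P\<^esub> f)"
      using P_closed[OF f] P_closed[OF g] by (simp add: t_def P_mult_2 f g K.m_comm K.a_comm)
  qed
  have fin: "finite B" by (simp add: B_def)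
  show "graded_frobenius_algebra K (skew_zigzag_algebra K {a} E v) (skew_zigzag_component K {a} E v)"
    unfolding alg comp
  proof (rule path_quotient_frobenius(1)[where deg = ?deg, OF ideal deg fin walks span tr van hom])
    fix g p assume a: "g \<in> carrier P" "p \<in> B"
    show "g p = \<zero>\<^bsub>K\<^esub>" if "\<And>y. y \<in> carrier P \<Longrightarrow> t (g \<otimes>\<^bsub>P\<^esub> y) = \<zero>\<^bsub>K\<^esub>"
      by (rule left[OF a(1) that a(2)])
    show "g p = \<zero>\<^bsub>K\<^esub>" if "\<And>y. y \<in> carrier P \<Longrightarrow> t (y \<otimes>\<^bsub>P\<^esub> g) = \<zero>\<^bsub>K\<^esub>"
      by (rule right[OF a(1) that a(2)])
  qed
  show "graded_symmetric_algebra K (skew_zigzag_algebra K {a} E v) (skew_zigzag_component K {a} E v)"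
    unfolding alg comp
  proof (rule path_quotient_frobenius(2)[where deg = ?deg, OF ideal deg fin walks span tr van hom _ _ sym])
    fix g p assume a: "g \<in> carrier P" "p \<in> B"
    show "g p = \<zero>\<^bsub>K\<^esub>" if "\<And>y. y \<in> carrier P \<Longrightarrow> t (g \<otimes>\<^bsub>P\<^esub> y) = \<zero>\<^bsub>K\<^esub>"
      by (rule left[OF a(1) that a(2)])
    show "g p = \<zero>\<^bsub>K\<^esub>" if "\<And>y. y \<in> carrier P \<Longrightarrow> t (y \<otimes>\<^bsub>P\<^esub> g) = \<zero>\<^bsub>K\<^esub>"
      by (rule right[OF a(1) that a(2)])
  qed
qed

theorem proposition3p9:
  fixes K :: "('k, 'm) ring_scheme"
    and V :: "'a set" and E :: "'a set set"
    and v :: "'a \<Rightarrow> 'a \<Rightarrow> 'a \<Rightarrow> 'k"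
  assumes "field K"
    and "simple_graph V E"
    and "connected_graph V E"
    and "skew_zigzag_coeffs K E v"
  shows "graded_frobenius_algebra K (skew_zigzag_algebra K V E v) (skew_zigzag_component K V E v) \<and>
    graded_symmetric_algebra K (zigzag_algebra K V E) (zigzag_component K V E)"
proof (cases "card V = 1")
  case True
  then obtain a where V: "V = {a}" using card_1_singletonE by blast
  show ?thesis
    unfolding zigzag_algebra_def zigzag_component_def V
    by (intro conjI one_vertex_frobenius_symmetric assms(1))
next
  case False
  interpret K: field K by fact
  have "V \<noteq> {}"
    using assms(3) by (simp add: connected_graph_def Digraph_Component.connected_def
        strongly_connected_def double_quiver_def)
  then have "card V \<noteq> 0" using assms(2) by (simp add: simple_graph_def)
  then have two: "card V \<ge> 2" using False by simp
  have one: "skew_zigzag_coeffs K E (\<lambda>a b c. \<one>\<^bsub>K\<^esub>)" by (simp add: skew_zigzag_coeffs_def)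
  interpret skew: skew_zigzag_graph K V E v
    by unfold_locales (use assms two in auto)
  interpret zigzag: skew_zigzag_graph K V E "\<lambda>a b c. \<one>\<^bsub>K\<^esub>"
    by unfold_locales (use assms two one in auto)
  show ?thesis
    unfolding zigzag_algebra_def zigzag_component_def
    using skew.skew_zigzag_frobenius zigzag.skew_zigzag_symmetric[OF refl] by blast
qed

end
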